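(* Consider the multi-target tracking model described in the context. Assume that, for every $\theta\in\Theta$, $\bar P_\theta=\bar P_{\theta^*}$ if and only if $\theta=\theta^*$, and that, for every $\psi\in\Psi$, $P_\psi=P_{\psi^*}$ if and only if $\psi=\psi^*$. Then: (a) if the true parameter $\boldsymbol\theta^*$ is in $\boldsymbol\Theta_{\lambda=0}$, then for any $\boldsymbol\theta\in\boldsymbol\Theta_{\lambda=0}$ it holds that $\bar{\boldsymbol P}_{\boldsymbol\theta}=\bar{\boldsymbol P}_{\boldsymbol\theta^*}$ if and only if $\boldsymbol\theta=\boldsymbol\theta^*$; (b) if the true parameter $\boldsymbol\theta^*$ is in $\boldsymbol\Theta|_{K=1}$, then for any $\boldsymbol\theta\in\boldsymbol\Theta|_{K=1}$ it holds that $\bar{\boldsymbol P}_{\boldsymbol\theta}=\bar{\boldsymbol P}_{\boldsymbol\theta^*}$ if and only if $\boldsymbol\theta=\boldsymbol\theta^*$.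
   Context: $\mathbb N$ is the set of positive integers, $\mathbb N_0=\mathbb N\cup\{0\}$. The state space $\mathbb X$ is a subset of $\mathbb R^{d'}$ with a reference measure $\mu$ (written $\mathrm dx$), the observation space $\mathbb Y$ is a subset of $\mathbb R^d$ with a reference measure $\mathrm dy$, and $\mathbb Y^\times=\bigcup_{k\ge 0}\mathbb Y^k$, where $\mathbb Y^0$ contains only the empty sequence. $\Theta$ and $\Psi$ are compact parameter sets. Single target: for $\theta\in\Theta$, $f_\theta(x\mid x')$ is a Markov transition density on $\mathbb X$ and $g_\theta(y\mid x)$ is a likelihood (a probability density in $y\in\mathbb Y$ for each $x\in\mathbb X$). The single-target hidden Markov model is $X_t\sim f_\theta(\cdot\mid x_{t-1})$, $Y_t\sim g_\theta(\cdot\mid x_t)$. The chain with transition $f_\theta$ is assumed to have a stationary distribution with density $\pi_\theta$. $\bar P_\theta$ denotes the law of the observation process $(Y_t)_{t\ge1}$ when $X_0\sim\pi_\theta$. Clutter: $P_\psi$, $\psi\in\Psi$, is a probability distribution on $\mathbb Y$ with density $p_\psi$. Multi-target model: let $S^{\mathrm T}\subset\mathbb N$ and $S^{\mathrm C}\subset(0,\infty)$ be compact. The parameter is $\boldsymbol\theta=(\theta,K,p_{\mathrm D},\lambda,\psi)\in\boldsymbol\Theta=\Theta\times S^{\mathrm T}\times(0,1)\times S^{\mathrm C}\times\Psi$ and the true parameter is $\boldsymbol\theta^*=(\theta^*,K^*,p_{\mathrm D}^*,\lambda^*,\psi^* )$. The $K$-target state $\boldsymbol X_t\in\mathbb X^K$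 has transition density $\boldsymbol f_{\boldsymbol\theta}(\boldsymbol x\mid\boldsymbol x')=\prod_{i=1}^K f_\theta(\boldsymbol x_i\mid\boldsymbol x_i')$ and, given $\boldsymbol X_t=\boldsymbol x$, the observation $\boldsymbol Y_t\in\mathbb Y^\times$ has (independently over time) the density, for $\boldsymbol y\in\mathbb Y^M$, $$\boldsymbol g_{\boldsymbol\theta}(\boldsymbol y\mid\boldsymbol x)=\sum_{\boldsymbol d\in\{0,1\}^K,\ |\boldsymbol d|\le M}\mathrm{Po}_\lambda(M-|\boldsymbol d|)\,\boldsymbol q_{\boldsymbol\theta}(\boldsymbol d)\,\frac1{M!}\sum_{\sigma\in\mathrm{Sym}(M)}\ \prod_{i=|\boldsymbol d|+1}^{M}p_\psi(\boldsymbol y_{\sigma(i)})\prod_{i=1}^{|\boldsymbol d|}g_\theta(\boldsymbol y_{\sigma(i)}\mid\boldsymbol x_{r(i)}),$$ where $|\boldsymbol d|=\sum_i\boldsymbol d_i$, $\boldsymbol q_{\boldsymbol\theta}(\boldsymbol d)=p_{\mathrm D}^{|\boldsymbol d|}(1-p_{\mathrm D})^{K-|\boldsymbol d|}$, $\mathrm{Po}_\lambda$ is the Poisson probability mass function with parameter $\lambda$, $\mathrm{Sym}(M)$ is the symmetric group on $\{1,\dots,M\}$, and $r(i)$ is the index of the $i$-th coordinate of $\boldsymbol d$ equal to $1$. (So each target is detected independently with probability $p_{\mathrm D}$, a Poisson($\lambda$) number of i.i.d. clutter points with density $p_\psi$ is added, and all observations are uniformly permuted.) $\bar{\boldsymbol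 P}_{\boldsymbol\theta}$ denotes the law of the observation process $(\boldsymbol Y_t)_{t\ge1}$ when $\boldsymbol X_0$ has the stationary density $\prod_{i=1}^K\pi_\theta(\boldsymbol x_i)$. Special parameter sets: $\boldsymbol\Theta_{\lambda=0}=\Theta\times S^{\mathrm T}\times(0,1)$ (parameters $(\theta,K,p_{\mathrm D})$) corresponds to the same model with no clutter, i.e. with $\mathrm{Po}_0$ understood as the point mass at $0$. $\boldsymbol\Theta|_{K=1}$ is the set of $(\theta,K,p_{\mathrm D},\lambda,\psi)\in\boldsymbol\Theta$ with $K=1$. *)

theory Defs
  imports "HOL-Probability.Probability"
begin

section \<open>Hidden Markov models\<close>

definition prob_density :: "'a measure \<Rightarrow> ('a \<Rightarrow> real) \<Rightarrow> bool" where
  "prob_density M h \<longleftrightarrow> h \<in> borel_measurable M \<and> (\<forall>x\<in>space M. 0 \<le> h x)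
     \<and> (\<integral>\<^sup>+x. ennreal (h x) \<partial>M) = 1"

text \<open>Conditional densities are written \<open>h x' x\<close> for \<open>h(x | x')\<close>: the conditioning variable
  comes first.\<close>

definition cond_density :: "'a measure \<Rightarrow> 'b measure \<Rightarrow> ('a \<Rightarrow> 'b \<Rightarrow> real) \<Rightarrow> bool" where
  "cond_density M N h \<longleftrightarrow> case_prod h \<in> borel_measurable (M \<Otimes>\<^sub>M N)
     \<and> (\<forall>x\<in>space M. prob_density N (h x))"

definition stationary_density :: "'a measure \<Rightarrow> ('a \<Rightarrow> 'a \<Rightarrow> real) \<Rightarrow> ('a \<Rightarrow> real) \<Rightarrow> bool" where
  "stationary_density M f \<pi> \<longleftrightarrow> prob_density M \<pi>
     \<and> bind (density M \<pi>) (\<lambda>x'. density M (f x')) = density M \<pi>"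

text \<open>Law of \<open>(X\<^sub>t)\<close>, \<open>t \<ge> 0\<close>, where \<open>X\<^sub>0\<close> has density \<open>\<pi>\<close> and the transition density is \<open>f\<close>,
  all densities with respect to \<open>M\<close>, as given by the Ionescu-Tulcea theorem.\<close>

definition chain_kernel ::
  "'x measure \<Rightarrow> ('x \<Rightarrow> real) \<Rightarrow> ('x \<Rightarrow> 'x \<Rightarrow> real) \<Rightarrow> nat \<Rightarrow> (nat \<Rightarrow> 'x) \<Rightarrow> 'x measure" where
  "chain_kernel M \<pi> f t \<omega> = (case t of 0 \<Rightarrow> density M \<pi> | Suc s \<Rightarrow> density M (f (\<omega> s)))"

definition chain_law ::
  "'x measure \<Rightarrow> ('x \<Rightarrow> real) \<Rightarrow> ('x \<Rightarrow> 'x \<Rightarrow> real) \<Rightarrow> (nat \<Rightarrow> 'x) measure" where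
  "chain_law M \<pi> f =
     projective_family.lim UNIV (Ionescu_Tulcea.CI (chain_kernel M \<pi> f) (\<lambda>_. M)) (\<lambda>_. M)"

lemma Ionescu_Tulcea_chain:
  assumes M: "sigma_finite_measure M" and "prob_density M \<pi>" and f: "cond_density M M f"
  shows "Ionescu_Tulcea (chain_kernel M \<pi> f) (\<lambda>_. M)"
  unfolding Ionescu_Tulcea_def
proof (intro conjI allI impI)
  interpret sigma_finite_measure M by fact
  have pr: "prob_space (density M h)" if "prob_density M h" for h
    using that unfolding prob_density_def
    by (intro prob_spaceI) (simp add: emeasure_density cong: nn_integral_cong)
  have m[measurable]: "case_prod f \<in> borel_measurable (M \<Otimes>\<^sub>M M)" using f by (simp add: cond_density_def)
  have k: "(\<lambda>x. density M (f x)) \<in> M \<rightarrow>\<^sub>M subprob_algebra M"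
  proof (rule measurable_subprob_algebra)
    fix a assume a: "a \<in> space M"
    show "subprob_space (density M (f a))"
      using f a pr by (auto simp: cond_density_def intro!: prob_space_imp_subprob_space)
    show "sets (density M (f a)) = sets M" by simp
  next
    fix A assume A[measurable]: "A \<in> sets M"
    have "(\<lambda>a. \<integral>\<^sup>+x. ennreal (f a x) * indicator A x \<partial>M) \<in> borel_measurable M"
      by measurable
    moreover have "emeasure (density M (f a)) A = (\<integral>\<^sup>+x. ennreal (f a x) * indicator A x \<partial>M)" if "a \<in> space M" for a
      using f that by (intro emeasure_density) (auto simp: cond_density_def prob_density_def)
    ultimately show "(\<lambda>a. emeasure (density M (f a)) A) \<in> borel_measurable M"
      by (simp cong: measurable_cong)
  qed
  show "chain_kernel M \<pi> f i \<in> PiM {0..<i} (\<lambda>_. M) \<rightarrow>\<^sub>M subprob_algebra M" for i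
  proof (cases i)
    case 0 then show ?thesis using pr[OF assms(2)]
      by (simp add: chain_kernel_def[abs_def] space_subprob_algebra prob_space_imp_subprob_space)
  next
    case (Suc s)
    have "(\<lambda>\<omega>. \<omega> s) \<in> PiM {0..<i} (\<lambda>_. M) \<rightarrow>\<^sub>M M"
      by (rule measurable_component_singleton) (simp add: Suc)
    from measurable_compose[OF this k] show ?thesis by (simp add: chain_kernel_def[abs_def] Suc)
  qed
  show "prob_space (chain_kernel M \<pi> f i x)" if "x \<in> space (PiM {0..<i} (\<lambda>_. M))" for i x
    using that assms f pr by (auto simp: chain_kernel_def cond_density_def space_PiM PiE_iff split: nat.split)
qed

text \<open>Law of \<open>(Y\<^sub>t)\<close>, \<open>t \<ge> 1\<close>: given the hidden path, the observations are independent and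
  \<open>Y\<^sub>t\<close> has density \<open>g(\<cdot> | x\<^sub>t)\<close> with respect to \<open>N\<close>.\<close>

definition hmm_obs_law ::
  "'x measure \<Rightarrow> 'y measure \<Rightarrow> ('x \<Rightarrow> real) \<Rightarrow> ('x \<Rightarrow> 'x \<Rightarrow> real) \<Rightarrow> ('x \<Rightarrow> 'y \<Rightarrow> real)
     \<Rightarrow> (nat \<Rightarrow> 'y) measure" where
  "hmm_obs_law M N \<pi> f g =
     bind (chain_law M \<pi> f) (\<lambda>x. PiM {1..} (\<lambda>t. density N (g (x t))))"


section \<open>Finite sequences of observations\<close>

text \<open>Elements of \<open>Y\<^sup>\<times>\<close>, the disjoint union of the powers of the observation space, are lists.
  Its sigma-algebra and reference measure are those of the disjoint union; on lists of length \<open>k\<close>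
  the reference measure is the \<open>k\<close>-fold product measure (a unit point mass if \<open>k = 0\<close>).\<close>

definition seq_slice :: "'y measure \<Rightarrow> nat \<Rightarrow> 'y list set \<Rightarrow> (nat \<Rightarrow> 'y) set" where
  "seq_slice N k A = {v \<in> space (PiM {..<k} (\<lambda>_. N)). map v [0..<k] \<in> A}"

definition seq_sets :: "'y measure \<Rightarrow> 'y list set set" where
  "seq_sets N = {A. A \<subseteq> lists (space N) \<and> (\<forall>k. seq_slice N k A \<in> sets (PiM {..<k} (\<lambda>_. N)))}"

definition seq_measure :: "'y measure \<Rightarrow> 'y list measure" where
  "seq_measure N = measure_of (lists (space N)) (seq_sets N)
     (\<lambda>A. \<Sum>k. emeasure (PiM {..<k} (\<lambda>_. N)) (seq_slice N k A))"

lemma seq_slice_Diff: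
  "seq_slice N k (lists (space N) - A) = space (PiM {..<k} (\<lambda>_. N)) - seq_slice N k A"
proof -
  have "map v [0..<k] \<in> lists (space N)" if "v \<in> space (PiM {..<k} (\<lambda>_. N))" for v
    using that by (force simp: space_PiM PiE_def Pi_def lists_eq_set)
  then show ?thesis
    unfolding seq_slice_def by blast
qed

lemma seq_slice_UN: "seq_slice N k (\<Union>i. A i) = (\<Union>i. seq_slice N k (A i))"
  by (auto simp: seq_slice_def)

lemma disjoint_family_seq_slice:
  "disjoint_family A \<Longrightarrow> disjoint_family (\<lambda>i. seq_slice N k (A i))"
  unfolding disjoint_family_on_def seq_slice_def by blast

lemma range_seq_setsD:
  assumes "range A \<subseteq> seq_sets N"
  shows "A i \<subseteq> lists (space N)" "seq_slice N k (A i) \<in> sets (PiM {..<k} (\<lambda>_. N))"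
  using assms by (auto simp: seq_sets_def)

lemma sigma_algebra_seq_sets: "sigma_algebra (lists (space N)) (seq_sets N)"
  unfolding sigma_algebra_iff2
proof (intro conjI allI ballI impI)
  show "seq_sets N \<subseteq> Pow (lists (space N))" by (auto simp: seq_sets_def)
  show "{} \<in> seq_sets N" by (auto simp: seq_sets_def seq_slice_def)
  show "lists (space N) - A \<in> seq_sets N" if "A \<in> seq_sets N" for A
    using that by (simp add: seq_sets_def sets.compl_sets seq_slice_Diff)
  show "(\<Union>i. A i) \<in> seq_sets N" if "range A \<subseteq> seq_sets N" for A :: "nat \<Rightarrow> _"
    using range_seq_setsD[OF that] unfolding seq_sets_def seq_slice_UN mem_Collect_eq
    by (intro conjI UN_least allI sets.countable_UN image_subsetI)
qed

lemma space_seq_measure [simp]: "space (seq_measure N) = lists (space N)"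
  unfolding seq_measure_def
  by (rule sigma_algebra.space_measure_of_eq[OF sigma_algebra_seq_sets])

lemma sets_seq_measure: "sets (seq_measure N) = seq_sets N"
  unfolding seq_measure_def
  by (rule sigma_algebra.sets_measure_of_eq[OF sigma_algebra_seq_sets])

lemma emeasure_seq_measure:
  assumes "A \<in> seq_sets N"
  shows "emeasure (seq_measure N) A = (\<Sum>k. emeasure (PiM {..<k} (\<lambda>_. N)) (seq_slice N k A))"
  unfolding seq_measure_def
proof (rule emeasure_measure_of_sigma[OF sigma_algebra_seq_sets _ _ assms])
  show "positive (seq_sets N) (\<lambda>A. \<Sum>k. emeasure (PiM {..<k} (\<lambda>_. N)) (seq_slice N k A))"
    by (simp add: positive_def seq_slice_def)
  show "countably_additive (seq_sets N)
     (\<lambda>A. \<Sum>k. emeasure (PiM {..<k} (\<lambda>_. N)) (seq_slice N k A))"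
  proof (rule countably_additiveI)
    fix A :: "nat \<Rightarrow> _"
    assume A: "range A \<subseteq> seq_sets N" "disjoint_family A"
    let ?e = "\<lambda>i k. emeasure (PiM {..<k} (\<lambda>_. N)) (seq_slice N k (A i))"
    have slice: "(\<Sum>i. ?e i k) = emeasure (PiM {..<k} (\<lambda>_. N)) (seq_slice N k (\<Union>i. A i))" for k
      unfolding seq_slice_UN using range_seq_setsD[OF A(1)] disjoint_family_seq_slice[OF A(2)]
      by (intro suminf_emeasure) auto
    have "(\<Sum>i. \<Sum>k. ?e i k) = (\<Sum>i. \<integral>\<^sup>+k. ?e i k \<partial>count_space UNIV)"
      by (simp only: nn_integral_count_space_nat)
    also have "\<dots> = (\<integral>\<^sup>+k. (\<Sum>i. ?e i k) \<partial>count_space UNIV)"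
      by (rule nn_integral_suminf[symmetric]) simp
    also have "\<dots> = (\<Sum>k. \<Sum>i. ?e i k)"
      by (simp only: nn_integral_count_space_nat)
    also have "\<dots> = (\<Sum>k. emeasure (PiM {..<k} (\<lambda>_. N)) (seq_slice N k (\<Union>i. A i)))"
      by (simp only: slice)
    finally show "(\<Sum>i. \<Sum>k. ?e i k)
        = (\<Sum>k. emeasure (PiM {..<k} (\<lambda>_. N)) (seq_slice N k (\<Union>i. A i)))" .
  qed
qed


section \<open>The multi-target model\<close>

text \<open>Targets and entries of a sequence are numbered from \<open>0\<close>.\<close>

text \<open>\<open>poisson_pmf\<close> is only specified for positive rates; the rate \<open>0\<close> means the point mass at \<open>0\<close>.\<close>

definition clutter_count :: "real \<Rightarrow> nat pmf" where
  "clutter_count lam = (if lam = 0 then return_pmf 0 else poisson_pmf lam)"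

definition num_detected :: "nat \<Rightarrow> (nat \<Rightarrow> nat) \<Rightarrow> nat" where
  "num_detected K d = (\<Sum>i<K. d i)"

definition detected_index :: "nat \<Rightarrow> (nat \<Rightarrow> nat) \<Rightarrow> nat \<Rightarrow> nat" where
  "detected_index K d i = sorted_list_of_set {j. j < K \<and> d j = 1} ! i"

definition detection_prob :: "nat \<Rightarrow> real \<Rightarrow> (nat \<Rightarrow> nat) \<Rightarrow> real" where
  "detection_prob K pD d = pD ^ num_detected K d * (1 - pD) ^ (K - num_detected K d)"

definition mt_likelihood ::
  "nat \<Rightarrow> real \<Rightarrow> real \<Rightarrow> ('y \<Rightarrow> real) \<Rightarrow> ('x \<Rightarrow> 'y \<Rightarrow> real) \<Rightarrow> (nat \<Rightarrow> 'x) \<Rightarrow> 'y list \<Rightarrow> real" where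
  "mt_likelihood K pD lam p g x ys =
     (let M = length ys in
      \<Sum>d \<in> {d \<in> {..<K} \<rightarrow>\<^sub>E {0, 1}. num_detected K d \<le> M}.
        pmf (clutter_count lam) (M - num_detected K d) * detection_prob K pD d * (1 / fact M) *
        (\<Sum>\<sigma> | \<sigma> permutes {..<M}.
           (\<Prod>i\<in>{num_detected K d..<M}. p (ys ! \<sigma> i)) *
           (\<Prod>i<num_detected K d. g (x (detected_index K d i)) (ys ! \<sigma> i))))"

definition mt_obs_law ::
  "'x measure \<Rightarrow> 'y measure \<Rightarrow> ('x \<Rightarrow> real) \<Rightarrow> ('x \<Rightarrow> 'x \<Rightarrow> real) \<Rightarrow> ('x \<Rightarrow> 'y \<Rightarrow> real)
     \<Rightarrow> nat \<Rightarrow> real \<Rightarrow> real \<Rightarrow> ('y \<Rightarrow> real) \<Rightarrow> (nat \<Rightarrow> 'y list) measure" where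
  "mt_obs_law \<mu> \<nu> \<pi> f g K pD lam p =
     hmm_obs_law (PiM {..<K} (\<lambda>_. \<mu>)) (seq_measure \<nu>)
       (\<lambda>x. \<Prod>i<K. \<pi> (x i)) (\<lambda>x' x. \<Prod>i<K. f (x' i) (x i)) (mt_likelihood K pD lam p g)"

locale multi_target_model =
  fixes \<mu> :: "(real ^ 'm) measure" and \<nu> :: "(real ^ 'n) measure"
    and \<XX> :: "(real ^ 'm) set" and \<YY> :: "(real ^ 'n) set"
    and \<Theta> :: "'th :: topological_space set" and \<Psi> :: "'ps :: topological_space set"
    and ST :: "nat set" and SC :: "real set"
    and f :: "'th \<Rightarrow> real ^ 'm \<Rightarrow> real ^ 'm \<Rightarrow> real"
    and g :: "'th \<Rightarrow> real ^ 'm \<Rightarrow> real ^ 'n \<Rightarrow> real"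
    and \<pi> :: "'th \<Rightarrow> real ^ 'm \<Rightarrow> real"
    and p :: "'ps \<Rightarrow> real ^ 'n \<Rightarrow> real"
  assumes sets_\<mu>: "sets \<mu> = sets (restrict_space borel \<XX>)" and sigma_finite_\<mu>: "sigma_finite_measure \<mu>"
    and sets_\<nu>: "sets \<nu> = sets (restrict_space borel \<YY>)" and sigma_finite_\<nu>: "sigma_finite_measure \<nu>"
    and compact_\<Theta>: "compact \<Theta>" and compact_\<Psi>: "compact \<Psi>"
    and ST: "compact ST" "ST \<subseteq> {1..}" and SC: "compact SC" "SC \<subseteq> {0<..}"
    and f: "\<And>\<theta>. \<theta> \<in> \<Theta> \<Longrightarrow> cond_density \<mu> \<mu> (f \<theta>)"
    and g: "\<And>\<theta>. \<theta> \<in> \<Theta> \<Longrightarrow> cond_density \<mu> \<nu> (g \<theta>)"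
    and \<pi>: "\<And>\<theta>. \<theta> \<in> \<Theta> \<Longrightarrow> stationary_density \<mu> (f \<theta>) (\<pi> \<theta>)"
    and p: "\<And>\<psi>. \<psi> \<in> \<Psi> \<Longrightarrow> prob_density \<nu> (p \<psi>)"

definition params :: "'th set \<Rightarrow> 'ps set \<Rightarrow> nat set \<Rightarrow> real set
    \<Rightarrow> ('th \<times> nat \<times> real \<times> real \<times> 'ps) set" where
  "params \<Theta> \<Psi> ST SC = \<Theta> \<times> ST \<times> {0<..<1} \<times> SC \<times> \<Psi>"

definition params_single_target :: "'th set \<Rightarrow> 'ps set \<Rightarrow> nat set \<Rightarrow> real set
    \<Rightarrow> ('th \<times> nat \<times> real \<times> real \<times> 'ps) set" where
  "params_single_target \<Theta> \<Psi> ST SC = {(\<theta>, K, pD, lam, \<psi>) \<in> params \<Theta> \<Psi> ST SC. K = 1}"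

definition params_no_clutter :: "'th set \<Rightarrow> nat set \<Rightarrow> ('th \<times> nat \<times> real) set" where
  "params_no_clutter \<Theta> ST = \<Theta> \<times> ST \<times> {0<..<1}"

definition obs_law ::
  "'x measure \<Rightarrow> 'y measure \<Rightarrow> ('th \<Rightarrow> 'x \<Rightarrow> 'x \<Rightarrow> real) \<Rightarrow> ('th \<Rightarrow> 'x \<Rightarrow> 'y \<Rightarrow> real)
     \<Rightarrow> ('th \<Rightarrow> 'x \<Rightarrow> real) \<Rightarrow> 'th \<Rightarrow> (nat \<Rightarrow> 'y) measure" where
  "obs_law \<mu> \<nu> f g \<pi> \<theta> = hmm_obs_law \<mu> \<nu> (\<pi> \<theta>) (f \<theta>) (g \<theta>)"

definition clutter_law :: "'y measure \<Rightarrow> ('ps \<Rightarrow> 'y \<Rightarrow> real) \<Rightarrow> 'ps \<Rightarrow> 'y measure" where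
  "clutter_law \<nu> p \<psi> = density \<nu> (p \<psi>)"

definition multi_obs_law ::
  "'x measure \<Rightarrow> 'y measure \<Rightarrow> ('th \<Rightarrow> 'x \<Rightarrow> 'x \<Rightarrow> real) \<Rightarrow> ('th \<Rightarrow> 'x \<Rightarrow> 'y \<Rightarrow> real)
     \<Rightarrow> ('th \<Rightarrow> 'x \<Rightarrow> real) \<Rightarrow> ('ps \<Rightarrow> 'y \<Rightarrow> real)
     \<Rightarrow> 'th \<times> nat \<times> real \<times> real \<times> 'ps \<Rightarrow> (nat \<Rightarrow> 'y list) measure" where
  "multi_obs_law \<mu> \<nu> f g \<pi> p =
     (\<lambda>(\<theta>, K, pD, lam, \<psi>). mt_obs_law \<mu> \<nu> (\<pi> \<theta>) (f \<theta>) (g \<theta>) K pD lam (p \<psi>))"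

text \<open>With \<open>lam = 0\<close> every summand of the likelihood in which the clutter density occurs is
  multiplied by \<open>0\<close>, so the density \<open>\<lambda>_. 0\<close> below is a dummy.\<close>

definition multi_obs_law_no_clutter ::
  "'x measure \<Rightarrow> 'y measure \<Rightarrow> ('th \<Rightarrow> 'x \<Rightarrow> 'x \<Rightarrow> real) \<Rightarrow> ('th \<Rightarrow> 'x \<Rightarrow> 'y \<Rightarrow> real)
     \<Rightarrow> ('th \<Rightarrow> 'x \<Rightarrow> real) \<Rightarrow> 'th \<times> nat \<times> real \<Rightarrow> (nat \<Rightarrow> 'y list) measure" where
  "multi_obs_law_no_clutter \<mu> \<nu> f g \<pi> =
     (\<lambda>(\<theta>, K, pD). mt_obs_law \<mu> \<nu> (\<pi> \<theta>) (f \<theta>) (g \<theta>) K pD 0 (\<lambda>_. 0))"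

end

theory Submission
  imports Defs
begin

text \<open>The events \<open>|Y\<^sub>t| = n\<^sub>t\<close>, all entries of \<open>Y\<^sub>t\<close> lie in \<open>A\<^sub>t\<close>, are invariant under permutations of the
  entries, so their probabilities do not see the random order of the observations.

  Without clutter, \<open>K\<close> is the largest possible number of observations and \<open>P(|Y\<^sub>1| = K) = p\<^sub>D ^ K\<close>. With
  \<open>n\<^sub>t = K\<close> for all \<open>t \<in> J\<close>, the event has probability \<open>p\<^sub>D ^ (K |J|)\<close> times the \<open>K\<close>-th power of the
  probability that the single-target observations satisfy \<open>Y\<^sub>t \<in> A\<^sub>t\<close>, \<open>t \<in> J\<close>; taking the \<open>K\<close>-th root
  recovers the single-target law.

  For one target in clutter, put \<open>a = \<lambda> P\<^sub>\<psi>(A)\<close> and \<open>b = p\<^sub>D / (1 - p\<^sub>D) P\<^sub>\<theta>(Y\<^sub>1 \<in> A)\<close>. Relative to the probability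
  of no observation, the events with \<open>n = 1\<close> and \<open>n = 2\<close> have weights \<open>a + b\<close> and \<open>a\<^sup>2 / 2 + a b\<close>, which
  determine \<open>b\<^sup>2 = (a + b)\<^sup>2 - 2 (a\<^sup>2 / 2 + a b)\<close> and hence \<open>a\<close> and \<open>b\<close>. The whole space gives \<open>\<lambda>\<close> and \<open>p\<^sub>D\<close>, and
  then general \<open>A\<close> give \<open>P\<^sub>\<psi>\<close>. Finally, the conditional probability of one observation in \<open>A\<^sub>t\<close> is an
  affine function of \<open>g(A\<^sub>t | X\<^sub>t)\<close> with known coefficients, so expanding products over \<open>t\<close> recovers
  the joint single-target probabilities.\<close>

section \<open>Densities and measurability in the conditioning variable\<close>

lemma prob_density_measurable: "prob_density M h \<Longrightarrow> h \<in> borel_measurable M"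
  by (simp add: prob_density_def)

lemma prob_space_density_prob_density: "prob_density M h \<Longrightarrow> prob_space (density M h)"
  unfolding prob_density_def
  by (intro prob_spaceI) (simp add: emeasure_density cong: nn_integral_cong)

lemma cond_density_measurable: "cond_density M N h \<Longrightarrow> case_prod h \<in> borel_measurable (M \<Otimes>\<^sub>M N)"
  by (simp add: cond_density_def)

lemma cond_density_prob_density: "cond_density M N h \<Longrightarrow> x \<in> space M \<Longrightarrow> prob_density N (h x)"
  by (simp add: cond_density_def)

text \<open>The probability of a fixed set is an integral of the jointly measurable density over the
  second variable, and \<sigma>-finiteness of \<open>N\<close> makes such an integral measurable in
  the first.\<close>

lemma borel_measurable_emeasure_density:
  assumes "sigma_finite_measure N" "cond_density M N h" and A[measurable]: "A \<in> sets N"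
  shows "(\<lambda>x. emeasure (density N (h x)) A) \<in> borel_measurable M"
proof -
  interpret sigma_finite_measure N by fact
  note cond_density_measurable[OF assms(2), measurable]
  have "(\<lambda>x. \<integral>\<^sup>+y. ennreal (h x y) * indicator A y \<partial>N) \<in> borel_measurable M"
    by measurable
  then show ?thesis
    using cond_density_prob_density[OF assms(2)]
    by (simp add: emeasure_density prob_density_measurable cong: measurable_cong)
qed

section \<open>Markov chains\<close>

text \<open>The expectation of \<open>\<phi>\<^sub>0(X\<^sub>0) \<cdots> \<phi>\<^sub>n\<^sub>-\<^sub>1(X\<^sub>n\<^sub>-\<^sub>1) \<psi>(X\<^sub>n)\<close>, integrated from the last variable backwards.\<close>

primrec chain_integral :: "'x measure \<Rightarrow> ('x \<Rightarrow> real) \<Rightarrow> ('x \<Rightarrow> 'x \<Rightarrow> real) \<Rightarrow> (nat \<Rightarrow> 'x \<Rightarrow> ennreal)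
    \<Rightarrow> nat \<Rightarrow> ('x \<Rightarrow> ennreal) \<Rightarrow> ennreal" where
  "chain_integral M \<pi> f \<phi> 0 \<psi> = (\<integral>\<^sup>+x. ennreal (\<pi> x) * \<psi> x \<partial>M)"
| "chain_integral M \<pi> f \<phi> (Suc n) \<psi> =
     chain_integral M \<pi> f \<phi> n (\<lambda>x. \<phi> n x * (\<integral>\<^sup>+x'. ennreal (f x x') * \<psi> x' \<partial>M))"

lemma chain_integral_cong:
  "(\<And>x. x \<in> space M \<Longrightarrow> \<psi> x = \<psi>' x) \<Longrightarrow> chain_integral M \<pi> f \<phi> n \<psi> = chain_integral M \<pi> f \<phi> n \<psi>'"
proof (induction n arbitrary: \<psi> \<psi>')
  case 0
  then show ?case by (auto intro!: nn_integral_cong)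
next
  case (Suc n)
  then have "(\<integral>\<^sup>+x'. ennreal (f x x') * \<psi> x' \<partial>M) = (\<integral>\<^sup>+x'. ennreal (f x x') * \<psi>' x' \<partial>M)" for x
    by (intro nn_integral_cong) auto
  then show ?case by simp
qed

locale density_chain = sigma_finite_measure M for M :: "'x measure" +
  fixes \<pi> :: "'x \<Rightarrow> real" and f :: "'x \<Rightarrow> 'x \<Rightarrow> real"
  assumes init: "prob_density M \<pi>" and trans: "cond_density M M f"
begin

sublocale IT: Ionescu_Tulcea "chain_kernel M \<pi> f" "\<lambda>_. M"
  by (rule Ionescu_Tulcea_chain) (unfold_locales, fact init, fact trans)

lemmas [measurable] = prob_density_measurable[OF init] cond_density_measurable[OF trans]

lemma borel_measurable_trans: "x \<in> space M \<Longrightarrow> f x \<in> borel_measurable M"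
  using cond_density_prob_density[OF trans] by (rule prob_density_measurable)

text \<open>\<open>IT.C 0 (Suc n)\<close> is the law of the states at times 0 to n; it starts from
  the empty history, whose only value is \<open>\<lambda>_. undefined\<close>. In the induction the
  last transition is integrated out, which leaves a new function of the state one step earlier, so
  \<open>\<psi>\<close> has to be arbitrary.\<close>

lemma nn_integral_C:
  assumes \<phi>[measurable]: "\<And>t. \<phi> t \<in> borel_measurable M" and "\<psi> \<in> borel_measurable M"
  shows "(\<integral>\<^sup>+x. (\<Prod>t<n. \<phi> t (x t)) * \<psi> (x n) \<partial>IT.C 0 (Suc n) (\<lambda>_. undefined)) = chain_integral M \<pi> f \<phi> n \<psi>"
  using assms(2)
proof (induction n arbitrary: \<psi>)
  case 0
  note 0[measurable]
  have u: "(\<lambda>_. undefined) \<in> space (PiM {0..<0::nat} (\<lambda>_. M))" by (simp add: space_PiM)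
  have "(\<integral>\<^sup>+x. (\<Prod>t<0. \<phi> t (x t)) * \<psi> (x 0) \<partial>IT.C 0 (Suc 0) (\<lambda>_. undefined))
     = (\<integral>\<^sup>+x. \<psi> (x 0) \<partial>IT.eP 0 (\<lambda>_. undefined))"
    by (simp only: IT.C.simps add_0_right bind_return[OF IT.measurable_eP u] lessThan_0 prod.empty mult_1_left)
  also have "\<dots> = (\<integral>\<^sup>+x. \<psi> x \<partial>density M \<pi>)"
    using u by (subst IT.nn_integral_eP) (auto simp: chain_kernel_def)
  also have "\<dots> = chain_integral M \<pi> f \<phi> 0 \<psi>"
    by (simp add: nn_integral_density)
  finally show ?case .
next
  case (Suc n)
  note Suc.prems[measurable]
  let ?u = "\<lambda>_::nat. undefined::'x"
  have u: "?u \<in> space (PiM {0..<0::nat} (\<lambda>_. M))" by (simp add: space_PiM)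
  let ?h = "\<lambda>x. \<integral>\<^sup>+x'. ennreal (f x x') * \<psi> x' \<partial>M"
  have "(\<integral>\<^sup>+x. (\<Prod>t<Suc n. \<phi> t (x t)) * \<psi> (x (Suc n)) \<partial>IT.C 0 (Suc (Suc n)) ?u)
     = (\<integral>\<^sup>+\<omega>. \<integral>\<^sup>+x. (\<Prod>t<Suc n. \<phi> t (x t)) * \<psi> (x (Suc n)) \<partial>IT.eP (Suc n) \<omega> \<partial>IT.C 0 (Suc n) ?u)"
    \<comment> \<open>Only the outermost transition is unfolded: the inner
      \<open>IT.C 0 (Suc n)\<close> is kept for the induction hypothesis.\<close>
    unfolding IT.C.simps(2)[of 0 "Suc n"]
    apply (subst nn_integral_bind[where B="PiM {0..<Suc (Suc n)} (\<lambda>_. M)"])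
    subgoal by measurable
    subgoal using IT.measurable_eP[of "Suc n"] IT.sets_C[OF u, of "Suc n"] by (simp cong: measurable_cong_sets)
    subgoal by simp
    done
  also have "\<dots> = (\<integral>\<^sup>+\<omega>. (\<Prod>t<n. \<phi> t (\<omega> t)) * (\<phi> n (\<omega> n) * ?h (\<omega> n)) \<partial>IT.C 0 (Suc n) ?u)"
  proof (rule nn_integral_cong)
    fix \<omega> assume "\<omega> \<in> space (IT.C 0 (Suc n) ?u)"
    then have \<omega>: "\<omega> \<in> space (PiM {0..<Suc n} (\<lambda>_. M))"
      using IT.space_C[OF u, of "Suc n"] by simp
    then have \<omega>n: "\<omega> n \<in> space M" by (auto simp: space_PiM PiE_iff)
    note borel_measurable_trans[OF \<omega>n, measurable]
    have "(\<integral>\<^sup>+x. (\<Prod>t<Suc n. \<phi> t (x t)) * \<psi> (x (Suc n)) \<partial>IT.eP (Suc n) \<omega>)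
       = (\<integral>\<^sup>+x. (\<Prod>t<Suc n. \<phi> t (fun_upd \<omega> (Suc n) x t)) * \<psi> (fun_upd \<omega> (Suc n) x (Suc n)) \<partial>chain_kernel M \<pi> f (Suc n) \<omega>)"
      by (rule IT.nn_integral_eP[OF \<omega>, where f="\<lambda>x. (\<Prod>t<Suc n. \<phi> t (x t)) * \<psi> (x (Suc n))"]) measurable
    also have "\<dots> = (\<integral>\<^sup>+x. (\<Prod>t<Suc n. \<phi> t (\<omega> t)) * \<psi> x \<partial>density M (f (\<omega> n)))"
      by (simp add: chain_kernel_def)
    also have "\<dots> = (\<Prod>t<Suc n. \<phi> t (\<omega> t)) * ?h (\<omega> n)"
      by (simp add: nn_integral_cmult nn_integral_density)
    finally show "(\<integral>\<^sup>+x. (\<Prod>t<Suc n. \<phi> t (x t)) * \<psi> (x (Suc n)) \<partial>IT.eP (Suc n) \<omega>)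
      = (\<Prod>t<n. \<phi> t (\<omega> t)) * (\<phi> n (\<omega> n) * ?h (\<omega> n))" by (simp add: mult.assoc)
  qed
  also have "\<dots> = chain_integral M \<pi> f \<phi> n (\<lambda>x. \<phi> n x * ?h x)"
    by (rule Suc.IH) measurable
  finally show ?case by simp
qed

lemma sets_chain_law[simp, measurable_cong]: "sets (chain_law M \<pi> f) = sets (PiM UNIV (\<lambda>_. M))"
  unfolding chain_law_def by simp

lemma space_chain_law[simp]: "space (chain_law M \<pi> f) = space (PiM UNIV (\<lambda>_. M))"
  unfolding chain_law_def by simp

lemma space_chain_lawD: "x \<in> space (chain_law M \<pi> f) \<Longrightarrow> x t \<in> space M"
  by (auto simp: space_PiM)

text \<open>The projective limit has the marginals \<open>IT.CI J\<close>, defined by projecting the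
  law up to the least time bound \<open>IT.up_to J\<close>. For an initial segment of length n this
  bound is n itself and the projection changes nothing.\<close>

lemma distr_chain_law:
  "distr (chain_law M \<pi> f) (PiM {0..<n} (\<lambda>_. M)) (\<lambda>x. restrict x {0..<n}) = IT.C 0 n (\<lambda>_. undefined)"
proof -
  have u: "(\<lambda>_. undefined) \<in> space (PiM {0..<0::nat} (\<lambda>_. M))" by (simp add: space_PiM)
  have "IT.up_to {0..<n} \<le> n" by (simp add: IT.up_to_iff)
  moreover have "n \<le> IT.up_to {0..<n}"
    using IT.up_to_iff_Ico[of "{0..<n}" "IT.up_to {0..<n}"] by auto
  ultimately have "IT.up_to {0..<n} = n" by simp
  then have "IT.CI {0..<n} = distr (IT.C 0 n (\<lambda>_. undefined)) (PiM {0..<n} (\<lambda>_. M)) (\<lambda>x. restrict x {0..<n})"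
    by (simp add: IT.CI_def)
  also have "\<dots> = IT.C 0 n (\<lambda>_. undefined)"
    using IT.distr_C[OF le_refl u, of n] by simp
  finally show ?thesis
    unfolding chain_law_def by (simp add: IT.distr_lim)
qed

text \<open>An image measure has the same total mass, so it is enough to look at the marginal on no
  coordinates at all.\<close>

lemma prob_space_chain_law: "prob_space (chain_law M \<pi> f)"
proof -
  have u: "(\<lambda>_. undefined) \<in> space (PiM {0..<0::nat} (\<lambda>_. M))" by (simp add: space_PiM)
  have m: "(\<lambda>x. restrict x {0..<0}) \<in> chain_law M \<pi> f \<rightarrow>\<^sub>M PiM {0..<0::nat} (\<lambda>_. M)"
    by measurable
  show ?thesis
    by (rule prob_space_distrD[OF m]) (simp only: distr_chain_law IT.prob_space_C[OF u])
qed

text \<open>The integrand sees only the first n + 1 states, so the infinite chain may be replaced by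
  its finite marginal.\<close>

lemma nn_integral_chain_law:
  assumes [measurable]: "\<And>t. \<phi> t \<in> borel_measurable M"
  shows "(\<integral>\<^sup>+x. (\<Prod>t<Suc n. \<phi> t (x t)) \<partial>chain_law M \<pi> f) = chain_integral M \<pi> f \<phi> n (\<phi> n)"
proof -
  have [measurable]: "(\<lambda>x. restrict x {0..<Suc n}) \<in> chain_law M \<pi> f \<rightarrow>\<^sub>M PiM {0..<Suc n} (\<lambda>_. M)"
    by measurable
  have "(\<integral>\<^sup>+x. (\<Prod>t<Suc n. \<phi> t (x t)) \<partial>chain_law M \<pi> f)
     = (\<integral>\<^sup>+x. (\<Prod>t<Suc n. \<phi> t (restrict x {0..<Suc n} t)) \<partial>chain_law M \<pi> f)"
    by (intro nn_integral_cong prod.cong) auto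
  also have "\<dots> = (\<integral>\<^sup>+x. (\<Prod>t<Suc n. \<phi> t (x t)) \<partial>distr (chain_law M \<pi> f) (PiM {0..<Suc n} (\<lambda>_. M)) (\<lambda>x. restrict x {0..<Suc n}))"
    by (rule nn_integral_distr[symmetric]) measurable
  also have "\<dots> = (\<integral>\<^sup>+x. (\<Prod>t<n. \<phi> t (x t)) * \<phi> n (x n) \<partial>IT.C 0 (Suc n) (\<lambda>_. undefined))"
    by (simp only: distr_chain_law) simp
  also have "\<dots> = chain_integral M \<pi> f \<phi> n (\<phi> n)"
    by (rule nn_integral_C) measurable
  finally show ?thesis .
qed

end

section \<open>Laws of the observations\<close>

locale density_hmm = density_chain M \<pi> f + N: sigma_finite_measure N
  for M :: "'x measure" and \<pi> f and N :: "'y measure" +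
  fixes g :: "'x \<Rightarrow> 'y \<Rightarrow> real"
  assumes obs: "cond_density M N g"
begin

lemmas measurable_obs_prob[measurable] =
  borel_measurable_emeasure_density[OF N.sigma_finite_measure_axioms obs]

lemma prob_space_obs: "x \<in> space M \<Longrightarrow> prob_space (density N (g x))"
  by (intro prob_space_density_prob_density cond_density_prob_density[OF obs])

text \<open>This makes the \<open>bind\<close> in \<open>hmm_obs_law\<close> a genuine mixture.
  Measurability is tested on the intersection-stable generator of cylinders, where independence
  given the path turns the kernel into a finite product of measurable functions.\<close>

lemma obs_kernel_measurable:
  "(\<lambda>x. PiM {1::nat..} (\<lambda>t. density N (g (x t)))) \<in> PiM UNIV (\<lambda>_. M) \<rightarrow>\<^sub>M prob_algebra (PiM {1..} (\<lambda>_. N))"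
proof (rule measurable_prob_algebra_generated[OF sets_PiM Int_stable_prod_algebra prod_algebra_sets_into_space])
  fix x :: "nat \<Rightarrow> 'x" assume x: "x \<in> space (PiM UNIV (\<lambda>_. M))"
  then have x: "prob_space (density N (g (x t)))" for t
    by (auto simp: space_PiM intro!: prob_space_obs)
  show "prob_space (PiM {1..} (\<lambda>t. density N (g (x t))))"
    using x by (rule prob_space_PiM)
  show "sets (PiM {1..} (\<lambda>t. density N (g (x t)))) = sets (PiM {1..} (\<lambda>_. N))"
    by (rule sets_PiM_cong) auto
next
  fix X assume "X \<in> prod_algebra {1::nat..} (\<lambda>_. N)"
  then obtain J E where X: "X = prod_emb {1..} (\<lambda>_. N) J (\<Pi>\<^sub>E j\<in>J. E j)"
    and J: "finite J" "J \<subseteq> {1..}" and E[measurable]: "\<And>j. j \<in> J \<Longrightarrow> E j \<in> sets N"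
    by (force elim!: prod_algebraE)
  have "(\<lambda>x. \<Prod>t\<in>J. emeasure (density N (g (x t))) (E t)) \<in> borel_measurable (PiM UNIV (\<lambda>_. M))"
    by measurable
  moreover have "emeasure (PiM {1..} (\<lambda>t. density N (g (x t)))) X = (\<Prod>t\<in>J. emeasure (density N (g (x t))) (E t))"
    if "x \<in> space (PiM UNIV (\<lambda>_. M))" for x
  proof -
    \<comment> \<open>An embedded cylinder depends on the component measures only through their
      spaces, and \<open>density\<close> keeps the space.\<close>
    have *: "prod_emb {1..} (\<lambda>_. N) J (\<Pi>\<^sub>E j\<in>J. E j) = prod_emb {1..} (\<lambda>t. density N (g (x t))) J (\<Pi>\<^sub>E j\<in>J. E j)"
      by (simp add: prod_emb_def)
    show ?thesis unfolding X *
      using that J E by (intro emeasure_PiM_emb) (auto simp: space_PiM intro!: prob_space_obs)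
  qed
  ultimately show "(\<lambda>x. emeasure (PiM {1..} (\<lambda>t. density N (g (x t)))) X) \<in> borel_measurable (PiM UNIV (\<lambda>_. M))"
    by (simp cong: measurable_cong)
qed

lemma chain_law_in_prob_algebra: "chain_law M \<pi> f \<in> space (prob_algebra (PiM UNIV (\<lambda>_. M)))"
  using prob_space_chain_law by (simp add: space_prob_algebra)

lemma sets_hmm_obs_law: "sets (hmm_obs_law M N \<pi> f g) = sets (PiM {1..} (\<lambda>_. N))"
  unfolding hmm_obs_law_def
  using sets_bind'[OF chain_law_in_prob_algebra obs_kernel_measurable] .

lemma prob_space_hmm_obs_law: "prob_space (hmm_obs_law M N \<pi> f g)"
  unfolding hmm_obs_law_def
  using prob_space_bind'[OF chain_law_in_prob_algebra obs_kernel_measurable] .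

lemma emeasure_hmm_obs_law:
  assumes J: "finite J" "J \<subseteq> {1..}" and A: "\<And>t. t \<in> J \<Longrightarrow> A t \<in> sets N"
  shows "emeasure (hmm_obs_law M N \<pi> f g) (prod_emb {1..} (\<lambda>_. N) J (Pi\<^sub>E J A))
    = (\<integral>\<^sup>+x. (\<Prod>t\<in>J. emeasure (density N (g (x t))) (A t)) \<partial>chain_law M \<pi> f)"
proof -
  have "emeasure (hmm_obs_law M N \<pi> f g) (prod_emb {1..} (\<lambda>_. N) J (Pi\<^sub>E J A))
    = (\<integral>\<^sup>+x. emeasure (PiM {1..} (\<lambda>t. density N (g (x t)))) (prod_emb {1..} (\<lambda>_. N) J (Pi\<^sub>E J A)) \<partial>chain_law M \<pi> f)"
    unfolding hmm_obs_law_def using J A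
    by (intro emeasure_bind_prob_algebra[OF chain_law_in_prob_algebra obs_kernel_measurable] sets_PiM_I) auto
  also have "\<dots> = (\<integral>\<^sup>+x. (\<Prod>t\<in>J. emeasure (density N (g (x t))) (A t)) \<partial>chain_law M \<pi> f)"
  proof (rule nn_integral_cong)
    fix x assume "x \<in> space (chain_law M \<pi> f)"
    then have x: "x t \<in> space M" for t by (rule space_chain_lawD)
    have *: "prod_emb {1..} (\<lambda>_. N) J (Pi\<^sub>E J A) = prod_emb {1..} (\<lambda>t. density N (g (x t))) J (Pi\<^sub>E J A)"
      by (simp add: prod_emb_def)
    show "emeasure (PiM {1..} (\<lambda>t. density N (g (x t)))) (prod_emb {1..} (\<lambda>_. N) J (Pi\<^sub>E J A))
      = (\<Prod>t\<in>J. emeasure (density N (g (x t))) (A t))"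
      unfolding * using x J A by (intro emeasure_PiM_emb) (auto intro!: prob_space_obs)
  qed
  finally show ?thesis .
qed

end

text \<open>A finite measure on the infinite product is determined by its finite-dimensional
  cylinders, whose probabilities are chain expectations of products of conditional probabilities.
  Both identifiability results end with this criterion.\<close>

lemma hmm_obs_law_eqI:
  assumes "density_hmm M \<pi> f N g" "density_hmm M \<pi>' f' N g'"
    and eq: "\<And>J A. finite J \<Longrightarrow> J \<subseteq> {1..} \<Longrightarrow> (\<And>t. t \<in> J \<Longrightarrow> A t \<in> sets N) \<Longrightarrow>
      (\<integral>\<^sup>+x. (\<Prod>t\<in>J. emeasure (density N (g (x t))) (A t)) \<partial>chain_law M \<pi> f)
      = (\<integral>\<^sup>+x. (\<Prod>t\<in>J. emeasure (density N (g' (x t))) (A t)) \<partial>chain_law M \<pi>' f')"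
  shows "hmm_obs_law M N \<pi> f g = hmm_obs_law M N \<pi>' f' g'"
proof -
  interpret H: density_hmm M \<pi> f N g by fact
  interpret H': density_hmm M \<pi>' f' N g' by fact
  show ?thesis
  proof (rule measure_eqI_PiM_infinite[OF H.sets_hmm_obs_law H'.sets_hmm_obs_law])
    show "finite_measure (hmm_obs_law M N \<pi> f g)"
      using H.prob_space_hmm_obs_law by (simp add: prob_space_def)
  qed (simp only: H.emeasure_hmm_obs_law H'.emeasure_hmm_obs_law eq)
qed

section \<open>Integration over finite sequences\<close>

lemma seq_slice_eqI:
  "(\<And>v. v \<in> space (PiM {..<k} (\<lambda>_. N)) \<Longrightarrow> map v [0..<k] \<in> A \<longleftrightarrow> P v) \<Longrightarrow>
    seq_slice N k A = {v \<in> space (PiM {..<k} (\<lambda>_. N)). P v}"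
  by (auto simp: seq_slice_def)

lemma map_upt_in_lists: "v \<in> space (PiM {..<k} (\<lambda>_. N)) \<Longrightarrow> map v [0..<k] \<in> lists (space N)"
  by (force simp: space_PiM PiE_def Pi_def lists_eq_set)

lemma measurable_map_upt[measurable]: "(\<lambda>v. map v [0..<k]) \<in> PiM {..<k} (\<lambda>_. N) \<rightarrow>\<^sub>M seq_measure N"
proof (rule measurableI)
  fix A assume "A \<in> sets (seq_measure N)"
  then have "seq_slice N k A \<in> sets (PiM {..<k} (\<lambda>_. N))"
    by (simp add: sets_seq_measure seq_sets_def)
  moreover have "(\<lambda>v. map v [0..<k]) -` A \<inter> space (PiM {..<k} (\<lambda>_. N)) = seq_slice N k A"
    by (auto simp: seq_slice_def)
  ultimately show "(\<lambda>v. map v [0..<k]) -` A \<inter> space (PiM {..<k} (\<lambda>_. N)) \<in> sets (PiM {..<k} (\<lambda>_. N))"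
    by simp
qed (simp add: map_upt_in_lists del: in_listsI)

text \<open>The reference measure is the sum over k of the images of the k-fold products under the
  passage to lists. The identity is extended from indicators to all nonnegative measurable
  functions; the limit step exchanges an increasing supremum with the integrals and with the series
  over lengths.\<close>

lemma nn_integral_seq_measure:
  assumes "h \<in> borel_measurable (seq_measure N)"
  shows "(\<integral>\<^sup>+ys. h ys \<partial>seq_measure N) = (\<Sum>k. \<integral>\<^sup>+v. h (map v [0..<k]) \<partial>PiM {..<k} (\<lambda>_. N))"
  using assms
proof (induction rule: borel_measurable_induct)
  case (cong h h')
  have "(\<integral>\<^sup>+v. h (map v [0..<k]) \<partial>PiM {..<k} (\<lambda>_. N)) = (\<integral>\<^sup>+v. h' (map v [0..<k]) \<partial>PiM {..<k} (\<lambda>_. N))" for k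
    by (intro nn_integral_cong cong(3)) (simp only: space_seq_measure map_upt_in_lists)
  moreover have "(\<integral>\<^sup>+ys. h ys \<partial>seq_measure N) = (\<integral>\<^sup>+ys. h' ys \<partial>seq_measure N)"
    using cong(3) by (intro nn_integral_cong)
  ultimately show ?case using cong(4) by simp
next
  case (set A)
  have "(\<integral>\<^sup>+v. indicator A (map v [0..<k]) \<partial>PiM {..<k} (\<lambda>_. N)) = emeasure (PiM {..<k} (\<lambda>_. N)) (seq_slice N k A)" for k
  proof -
    have "(\<integral>\<^sup>+v. indicator A (map v [0..<k]) \<partial>PiM {..<k} (\<lambda>_. N))
      = (\<integral>\<^sup>+v. indicator (seq_slice N k A) v \<partial>PiM {..<k} (\<lambda>_. N))"
      by (intro nn_integral_cong) (auto simp: seq_slice_def split: split_indicator)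
    also have "\<dots> = emeasure (PiM {..<k} (\<lambda>_. N)) (seq_slice N k A)"
      using set by (intro nn_integral_indicator) (simp add: sets_seq_measure seq_sets_def)
    finally show ?thesis .
  qed
  with set show ?case
    by (simp add: emeasure_seq_measure sets_seq_measure)
next
  case (mult u c)
  note mult(2)[measurable]
  show ?case using mult by (simp add: nn_integral_cmult)
next
  case (add u v)
  note [measurable] = add.hyps(1,3)
  have "(\<Sum>k. \<integral>\<^sup>+w. v (map w [0..<k]) + u (map w [0..<k]) \<partial>PiM {..<k} (\<lambda>_. N))
    = (\<Sum>k. (\<integral>\<^sup>+w. v (map w [0..<k]) \<partial>PiM {..<k} (\<lambda>_. N)) + (\<integral>\<^sup>+w. u (map w [0..<k]) \<partial>PiM {..<k} (\<lambda>_. N)))"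
    by (intro suminf_cong nn_integral_add measurable_compose[OF measurable_map_upt] add.hyps(1,3))
  also have "\<dots> = (\<Sum>k. \<integral>\<^sup>+w. v (map w [0..<k]) \<partial>PiM {..<k} (\<lambda>_. N)) + (\<Sum>k. \<integral>\<^sup>+w. u (map w [0..<k]) \<partial>PiM {..<k} (\<lambda>_. N))"
    by (rule suminf_add[symmetric]) auto
  also have "\<dots> = (\<integral>\<^sup>+ys. v ys + u ys \<partial>seq_measure N)"
    unfolding add.IH[symmetric] by (rule nn_integral_add[symmetric]) (fact add.hyps)+
  finally show ?case by simp
next
  case (seq U)
  note seq.hyps(1)[measurable]
  have inc: "incseq (\<lambda>i v. U i (map v [0..<k]))" for k
    using seq.hyps(3) by (auto simp: incseq_def le_fun_def)
  have "(\<integral>\<^sup>+ys. (SUP i. U i) ys \<partial>seq_measure N) = (SUP i. \<integral>\<^sup>+ys. U i ys \<partial>seq_measure N)"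
    unfolding SUP_apply using seq.hyps(1,3) by (rule nn_integral_monotone_convergence_SUP[rotated])
  also have "\<dots> = (SUP i. \<Sum>k. \<integral>\<^sup>+v. U i (map v [0..<k]) \<partial>PiM {..<k} (\<lambda>_. N))"
    by (simp only: seq.IH)
  also have "\<dots> = (\<Sum>k. SUP i. \<integral>\<^sup>+v. U i (map v [0..<k]) \<partial>PiM {..<k} (\<lambda>_. N))"
    using inc by (intro ennreal_suminf_SUP_eq[symmetric]) (auto simp: incseq_def le_fun_def intro!: nn_integral_mono)
  also have "\<dots> = (\<Sum>k. \<integral>\<^sup>+v. (SUP i. U i) (map v [0..<k]) \<partial>PiM {..<k} (\<lambda>_. N))"
    unfolding SUP_apply 
    by (intro suminf_cong nn_integral_monotone_convergence_SUP[symmetric] inc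
        measurable_compose[OF measurable_map_upt seq.hyps(1)])
  finally show ?case .
qed

section \<open>Boxes of sequences and \<sigma>-finiteness\<close>

definition seq_box :: "nat \<Rightarrow> 'y set \<Rightarrow> 'y list set" where
  "seq_box k A = {ys \<in> lists A. length ys = k}"

lemma seq_slice_box:
  assumes "A \<subseteq> space N"
  shows "seq_slice N j (seq_box k A) = (if j = k then Pi\<^sub>E {..<k} (\<lambda>_. A) else {})"
proof -
  have "v i \<in> space N" if "v \<in> {..<k} \<rightarrow>\<^sub>E A" "i < k" for v i
    using that assms by auto
  then show ?thesis
    by (auto simp: seq_slice_def seq_box_def space_PiM in_lists_conv_set PiE_iff extensional_def)
qed

lemma sets_seq_box[measurable]:
  assumes A: "A \<in> sets N" shows "seq_box k A \<in> sets (seq_measure N)"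
proof -
  have "seq_box k A \<subseteq> lists (space N)"
    using sets.sets_into_space[OF A] by (auto simp: seq_box_def)
  then show ?thesis
    using A by (auto simp: sets_seq_measure seq_sets_def seq_slice_box[OF sets.sets_into_space[OF A]] sets_PiM_I_finite)
qed

lemma measurable_length_seq[measurable]: "length \<in> seq_measure N \<rightarrow>\<^sub>M count_space UNIV"
proof (rule measurable_count_space_eq2_countable[THEN iffD2])
  have "length -` {k} \<inter> space (seq_measure N) = seq_box k (space N)" for k
    by (auto simp: seq_box_def)
  then show "length \<in> space (seq_measure N) \<rightarrow> UNIV \<and> (\<forall>a\<in>UNIV. length -` {a} \<inter> space (seq_measure N) \<in> sets (seq_measure N))"
    by auto
qed

text \<open>The default value \<open>a\<close> stands in for entries beyond the end of the list, so
  that each entry becomes a function with values in \<open>N\<close> on lists of every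
  length.\<close>

lemma measurable_nth_seq:
  assumes a: "a \<in> space N"
  shows "(\<lambda>ys. if i < length ys then ys ! i else a) \<in> seq_measure N \<rightarrow>\<^sub>M N"
proof (rule measurableI)
  fix A assume A[measurable]: "A \<in> sets N"
  let ?X = "(\<lambda>ys. if i < length ys then ys ! i else a) -` A \<inter> space (seq_measure N)"
  have "seq_slice N k ?X = {v \<in> space (PiM {..<k} (\<lambda>_. N)). (if i < k then v i else a) \<in> A}" for k
    by (rule seq_slice_eqI) (frule map_upt_in_lists, auto)
  moreover have "{v \<in> space (PiM {..<k} (\<lambda>_. N)). (if i < k then v i else a) \<in> A} \<in> sets (PiM {..<k} (\<lambda>_. N))" for k
    by (cases "i < k") (auto intro!: sets_Collect_single)
  ultimately show "?X \<in> sets (seq_measure N)"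
    by (auto simp: sets_seq_measure seq_sets_def)
qed (use a in \<open>auto simp: in_lists_conv_set\<close>)

text \<open>Take an increasing exhaustion of \<open>N\<close> by sets of finite measure. The boxes
  over its members are countably many, have finite measure, being powers of finite numbers, and
  cover all lists, since the finitely many entries of a list lie in a common member.\<close>

lemma sigma_finite_seq_measure:
  assumes "sigma_finite_measure N"
  shows "sigma_finite_measure (seq_measure N)"
proof -
  interpret N: sigma_finite_measure N by fact
  interpret product_sigma_finite "\<lambda>_::nat. N" by unfold_locales
  obtain A :: "nat \<Rightarrow> _" where A: "range A \<subseteq> sets N" "(\<Union>i. A i) = space N"
    "\<And>i. emeasure N (A i) \<noteq> \<infinity>" "incseq A"
    by (rule N.sigma_finite_incseq) blast
  have Ai[measurable]: "A i \<in> sets N" for i using A(1) by auto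
  let ?B = "(\<lambda>(k, i). seq_box k (A i)) ` UNIV"
  show ?thesis
  proof
    show "\<exists>B. countable B \<and> B \<subseteq> sets (seq_measure N) \<and> \<Union>B = space (seq_measure N) \<and>
      (\<forall>a\<in>B. emeasure (seq_measure N) a \<noteq> \<infinity>)"
    proof (intro exI[of _ ?B] conjI ballI)
      show "countable ?B" by (intro countable_image) simp
      show "?B \<subseteq> sets (seq_measure N)" by (auto intro!: sets_seq_box)
      then have 1: "\<Union>?B \<subseteq> space (seq_measure N)" using sets.sets_into_space by blast
      have 2: "ys \<in> \<Union>?B" if "ys \<in> space (seq_measure N)" for ys
      proof -
        from that have ys: "ys \<in> lists (space N)" by simp
        have "\<exists>i. y \<in> A i" if "y \<in> set ys" for y
          using that ys A(2) by auto
        then obtain F where F: "\<And>y. y \<in> set ys \<Longrightarrow> y \<in> A (F y)" by metis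
        \<comment> \<open>The largest index serves all entries because the exhaustion is increasing.
          For the empty list the index is unspecified, and any box of length 0 contains that
          list.\<close>
        have "y \<in> A (Max (F ` set ys))" if "y \<in> set ys" for y
          using F[OF that] incseqD[OF A(4), of "F y" "Max (F ` set ys)"] that by auto
        then have "ys \<in> seq_box (length ys) (A (Max (F ` set ys)))"
          by (auto simp: seq_box_def)
        then show ?thesis by blast
      qed
      show "\<Union>?B = space (seq_measure N)" by (rule equalityI[OF 1 subsetI[OF 2]])
      fix b assume "b \<in> ?B"
      then obtain k i where b: "b = seq_box k (A i)" by auto
      have "emeasure (seq_measure N) b = (\<Sum>j. if j = k then emeasure (PiM {..<k} (\<lambda>_. N)) (Pi\<^sub>E {..<k} (\<lambda>_. A i)) else 0)"
        unfolding b using sets_seq_box[OF Ai]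
        by (subst emeasure_seq_measure)
           (auto simp: sets_seq_measure seq_slice_box[OF sets.sets_into_space[OF Ai]] intro!: suminf_cong)
      also have "\<dots> = emeasure (PiM {..<k} (\<lambda>_. N)) (Pi\<^sub>E {..<k} (\<lambda>_. A i))"
        by (subst suminf_finite[of "{k}"]) auto
      also have "\<dots> = emeasure N (A i) ^ k"
        by (simp add: emeasure_PiM)
      finally show "emeasure (seq_measure N) b \<noteq> \<infinity>"
        using A(3)[of i] by (simp add: power_eq_top_ennreal)
    qed
  qed
qed

lemma nn_integral_seq_box:
  assumes h: "h \<in> borel_measurable (seq_measure N)" and A: "A \<in> sets N"
  shows "(\<integral>\<^sup>+ys. h ys * indicator (seq_box k A) ys \<partial>seq_measure N)
    = (\<integral>\<^sup>+v. h (map v [0..<k]) * (\<Prod>i<k. indicator A (v i)) \<partial>PiM {..<k} (\<lambda>_. N))"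
proof -
  note h[measurable] A[measurable]
  have "map v [0..<j] \<in> seq_box k A \<longleftrightarrow> j = k \<and> (\<forall>i<k. v i \<in> A)" for j and v :: "nat \<Rightarrow> _"
    by (auto simp: seq_box_def in_lists_conv_set)
  moreover have "(\<Prod>i<k. indicator A (v i)) = (if \<forall>i<k. v i \<in> A then 1 else 0 :: ennreal)" for v :: "nat \<Rightarrow> _"
    by (auto simp: indicator_def)
  ultimately have ind: "indicator (seq_box k A) (map v [0..<j]) = (if j = k then \<Prod>i<k. indicator A (v i) else 0 :: ennreal)" for j v
    by (simp add: indicator_def)
  have "(\<integral>\<^sup>+ys. h ys * indicator (seq_box k A) ys \<partial>seq_measure N)
    = (\<Sum>j. \<integral>\<^sup>+v. h (map v [0..<j]) * indicator (seq_box k A) (map v [0..<j]) \<partial>PiM {..<j} (\<lambda>_. N))"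
    by (rule nn_integral_seq_measure) measurable
  also have "\<dots> = (\<Sum>j. if j = k then \<integral>\<^sup>+v. h (map v [0..<k]) * (\<Prod>i<k. indicator A (v i)) \<partial>PiM {..<k} (\<lambda>_. N) else 0)"
    by (intro suminf_cong) (simp add: ind)
  also have "\<dots> = (\<integral>\<^sup>+v. h (map v [0..<k]) * (\<Prod>i<k. indicator A (v i)) \<partial>PiM {..<k} (\<lambda>_. N))"
    by (subst suminf_finite[of "{k}"]) auto
  finally show ?thesis .
qed

section \<open>Products of independent chains\<close>

lemma prob_density_PiM: 
  assumes N: "sigma_finite_measure N" and h: "\<And>i. i < K \<Longrightarrow> prob_density N (h i)"
  shows "prob_density (PiM {..<K::nat} (\<lambda>_. N)) (\<lambda>x. \<Prod>i<K. h i (x i))"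
proof -
  interpret N: sigma_finite_measure N by fact
  interpret product_sigma_finite "\<lambda>_::nat. N" by unfold_locales
  have [measurable]: "h i \<in> borel_measurable N" if "i < K" for i
    using h[OF that] by (rule prob_density_measurable)
  have "(\<lambda>x. \<Prod>i<K. h i (x i)) \<in> borel_measurable (PiM {..<K} (\<lambda>_. N))"
    by (intro borel_measurable_prod measurable_compose[OF measurable_component_singleton]) auto
  moreover have "0 \<le> h i (x i)" if "x \<in> space (PiM {..<K} (\<lambda>_. N))" "i < K" for x i
    using that h[of i] by (auto simp: prob_density_def space_PiM PiE_iff)
  moreover from this have "(\<integral>\<^sup>+x. ennreal (\<Prod>i<K. h i (x i)) \<partial>PiM {..<K} (\<lambda>_. N)) = (\<integral>\<^sup>+x. (\<Prod>i<K. ennreal (h i (x i))) \<partial>PiM {..<K} (\<lambda>_. N))"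
    by (intro nn_integral_cong prod_ennreal[symmetric]) auto
  moreover have "\<dots> = (\<Prod>i<K. \<integral>\<^sup>+x. ennreal (h i x) \<partial>N)"
    by (rule product_nn_integral_prod) auto
  moreover have "\<dots> = 1"
    using h by (intro prod.neutral) (auto simp: prob_density_def)
  ultimately show ?thesis
    by (auto simp: prob_density_def intro!: prod_nonneg)
qed

context density_chain
begin

lemma sigma_finite_PiM: "sigma_finite_measure (PiM {..<K::nat} (\<lambda>_. M))"
proof -
  interpret finite_product_sigma_finite "\<lambda>_::nat. M" "{..<K}" by unfold_locales auto
  show ?thesis by unfold_locales
qed

lemma density_chain_PiM:
  "density_chain (PiM {..<K::nat} (\<lambda>_. M)) (\<lambda>x. \<Prod>i<K. \<pi> (x i)) (\<lambda>x' x. \<Prod>i<K. f (x' i) (x i))"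
proof -
  interpret P: sigma_finite_measure "PiM {..<K::nat} (\<lambda>_. M)" by (rule sigma_finite_PiM)
  show ?thesis
  proof
    show "prob_density (PiM {..<K} (\<lambda>_. M)) (\<lambda>x. \<Prod>i<K. \<pi> (x i))"
      by (intro prob_density_PiM init) unfold_locales
    show "cond_density (PiM {..<K} (\<lambda>_. M)) (PiM {..<K} (\<lambda>_. M)) (\<lambda>x' x. \<Prod>i<K. f (x' i) (x i))"
      unfolding cond_density_def
    proof (intro conjI ballI)
      show "(\<lambda>(x', x). \<Prod>i<K. f (x' i) (x i)) \<in> borel_measurable (PiM {..<K} (\<lambda>_. M) \<Otimes>\<^sub>M PiM {..<K} (\<lambda>_. M))"
        by measurable
      show "prob_density (PiM {..<K} (\<lambda>_. M)) (\<lambda>x. \<Prod>i<K. f (x' i) (x i))" if "x' \<in> space (PiM {..<K} (\<lambda>_. M))" for x'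
        using that by (intro prob_density_PiM cond_density_prob_density[OF trans] sigma_finite_measure_axioms)
          (auto simp: space_PiM PiE_iff)
    qed
  qed
qed

text \<open>The targets move independently, so each backward integration splits over the coordinates
  by Tonelli and maps a product over targets to a product over targets. All targets have the same
  dynamics, hence the K-th power.\<close>

lemma chain_integral_PiM:
  assumes \<phi>[measurable]: "\<And>t. \<phi> t \<in> borel_measurable M" and "\<psi> \<in> borel_measurable M"
  shows "chain_integral (PiM {..<K::nat} (\<lambda>_. M)) (\<lambda>x. \<Prod>i<K. \<pi> (x i)) (\<lambda>x' x. \<Prod>i<K. f (x' i) (x i))
      (\<lambda>t x. \<Prod>i<K. \<phi> t (x i)) n (\<lambda>x. \<Prod>i<K. \<psi> (x i)) = chain_integral M \<pi> f \<phi> n \<psi> ^ K"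
  using assms(2)
proof (induction n arbitrary: \<psi>)
  interpret product_sigma_finite "\<lambda>_::nat. M" by unfold_locales
  \<comment> \<open>The densities \<open>h i\<close> may differ between coordinates: in the initial
    step they all equal \<open>\<pi>\<close>, but in a transition they are \<open>f (x i)\<close>,
    which depends on the position of the i-th target.\<close>
  have split: "(\<integral>\<^sup>+x. ennreal (\<Prod>i<K. h i (x i)) * (\<Prod>i<K. \<psi> (x i)) \<partial>PiM {..<K} (\<lambda>_. M))
    = (\<Prod>i<K. \<integral>\<^sup>+x. ennreal (h i x) * \<psi> x \<partial>M)"
    if h: "\<And>i. i < K \<Longrightarrow> prob_density M (h i)" and \<psi>[measurable]: "\<psi> \<in> borel_measurable M" for h \<psi>
  proof -
    have [measurable]: "h i \<in> borel_measurable M" if "i < K" for i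
      using h[OF that] by (rule prob_density_measurable)
    have "0 \<le> h i (x i)" if "x \<in> space (PiM {..<K} (\<lambda>_. M))" "i < K" for x i
      using that h[of i] by (auto simp: prob_density_def space_PiM PiE_iff)
    then have "(\<integral>\<^sup>+x. ennreal (\<Prod>i<K. h i (x i)) * (\<Prod>i<K. \<psi> (x i)) \<partial>PiM {..<K} (\<lambda>_. M))
      = (\<integral>\<^sup>+x. (\<Prod>i<K. ennreal (h i (x i)) * \<psi> (x i)) \<partial>PiM {..<K} (\<lambda>_. M))"
      by (intro nn_integral_cong) (simp only: prod.distrib, subst prod_ennreal, auto)
    also have "\<dots> = (\<Prod>i<K. \<integral>\<^sup>+x. ennreal (h i x) * \<psi> x \<partial>M)"
      by (rule product_nn_integral_prod) auto
    finally show ?thesis .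
  qed
  {
    case 0
    then show ?case using split[of "\<lambda>_. \<pi>" \<psi>] init by simp
  next
    case (Suc n)
    note Suc.prems[measurable]
    have "chain_integral (PiM {..<K} (\<lambda>_. M)) (\<lambda>x. \<Prod>i<K. \<pi> (x i)) (\<lambda>x' x. \<Prod>i<K. f (x' i) (x i))
        (\<lambda>t x. \<Prod>i<K. \<phi> t (x i)) (Suc n) (\<lambda>x. \<Prod>i<K. \<psi> (x i))
      = chain_integral (PiM {..<K} (\<lambda>_. M)) (\<lambda>x. \<Prod>i<K. \<pi> (x i)) (\<lambda>x' x. \<Prod>i<K. f (x' i) (x i))
        (\<lambda>t x. \<Prod>i<K. \<phi> t (x i)) n (\<lambda>x. \<Prod>i<K. \<phi> n (x i) * (\<integral>\<^sup>+x'. ennreal (f (x i) x') * \<psi> x' \<partial>M))"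
      unfolding chain_integral.simps
    proof (rule chain_integral_cong)
      fix x assume x: "x \<in> space (PiM {..<K} (\<lambda>_. M))"
      have "(\<integral>\<^sup>+x'. ennreal (\<Prod>i<K. f (x i) (x' i)) * (\<Prod>i<K. \<psi> (x' i)) \<partial>PiM {..<K} (\<lambda>_. M))
        = (\<Prod>i<K. \<integral>\<^sup>+x'. ennreal (f (x i) x') * \<psi> x' \<partial>M)"
        using x by (intro split cond_density_prob_density[OF trans] Suc.prems) (auto simp: space_PiM PiE_iff)
      then show "(\<Prod>i<K. \<phi> n (x i)) * (\<integral>\<^sup>+x'. ennreal (\<Prod>i<K. f (x i) (x' i)) * (\<Prod>i<K. \<psi> (x' i)) \<partial>PiM {..<K} (\<lambda>_. M))
        = (\<Prod>i<K. \<phi> n (x i) * (\<integral>\<^sup>+x'. ennreal (f (x i) x') * \<psi> x' \<partial>M))"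
        by (simp add: prod.distrib)
    qed
    also have "\<dots> = chain_integral M \<pi> f \<phi> n (\<lambda>x. \<phi> n x * (\<integral>\<^sup>+x'. ennreal (f x x') * \<psi> x' \<partial>M)) ^ K"
      by (rule Suc.IH) measurable
    finally show ?case by simp
  }
qed

lemma nn_integral_chain_law_PiM:
  assumes J: "finite J" and \<phi>: "\<And>t. t \<in> J \<Longrightarrow> \<phi> t \<in> borel_measurable M"
  shows "(\<integral>\<^sup>+x. (\<Prod>t\<in>J. \<Prod>i<K. \<phi> t (x t i))
        \<partial>chain_law (PiM {..<K::nat} (\<lambda>_. M)) (\<lambda>x. \<Prod>i<K. \<pi> (x i)) (\<lambda>x' x. \<Prod>i<K. f (x' i) (x i)))
    = (\<integral>\<^sup>+x. (\<Prod>t\<in>J. \<phi> t (x t)) \<partial>chain_law M \<pi> f) ^ K"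
proof -
  interpret P: density_chain "PiM {..<K::nat} (\<lambda>_. M)" "\<lambda>x. \<Prod>i<K. \<pi> (x i)" "\<lambda>x' x. \<Prod>i<K. f (x' i) (x i)"
    by (rule density_chain_PiM)
  \<comment> \<open>Times outside \<open>J\<close> receive the factor 1, so that an arbitrary finite
    set of times is covered by the formula for initial segments.\<close>
  define \<phi>' where "\<phi>' t = (if t \<in> J then \<phi> t else (\<lambda>_. 1))" for t
  have \<phi>'[measurable]: "\<phi>' t \<in> borel_measurable M" for t using \<phi> by (simp add: \<phi>'_def)
  obtain n where n: "J \<subseteq> {..<Suc n}"
    using J finite_nat_iff_bounded[of J] by (metis lessThan_Suc subset_insertI2)
  have ext: "(\<Prod>t\<in>J. F t) = (\<Prod>t<Suc n. if t \<in> J then F t else 1)" for F :: "nat \<Rightarrow> ennreal"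
    using n by (intro prod.mono_neutral_cong_left) auto
  have "(\<Prod>t\<in>J. \<Prod>i<K. \<phi> t (x t i)) = (\<Prod>t<Suc n. \<Prod>i<K. \<phi>' t (x t i))" for x
    unfolding ext by (intro prod.cong) (auto simp: \<phi>'_def)
  moreover have "(\<Prod>t\<in>J. \<phi> t (x t)) = (\<Prod>t<Suc n. \<phi>' t (x t))" for x
    unfolding ext by (intro prod.cong) (auto simp: \<phi>'_def)
  moreover have "(\<lambda>x. \<Prod>i<K. \<phi>' t (x i)) \<in> borel_measurable (PiM {..<K} (\<lambda>_. M))" for t
    by measurable
  ultimately show ?thesis
    using P.nn_integral_chain_law[of "\<lambda>t x. \<Prod>i<K. \<phi>' t (x i)" n]
    by (simp only: nn_integral_chain_law[OF \<phi>'] chain_integral_PiM[OF \<phi>' \<phi>'])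
qed

end

section \<open>The likelihood of the multi-target model\<close>

lemma num_detected_eq_card:
  assumes "d \<in> {..<K} \<rightarrow>\<^sub>E {0, 1}"
  shows "num_detected K d = card {j. j < K \<and> d j = 1}"
proof -
  have "num_detected K d = (\<Sum>j<K. if d j = 1 then 1 else 0)"
    unfolding num_detected_def using assms by (intro sum.cong) (auto simp: PiE_iff)
  also have "\<dots> = card {j. j < K \<and> d j = 1}"
    by (subst sum.If_cases) (auto intro!: arg_cong[where f=card])
  finally show ?thesis .
qed

lemma num_detected_le: "d \<in> {..<K} \<rightarrow>\<^sub>E {0, 1} \<Longrightarrow> num_detected K d \<le> K"
  using card_mono[of "{..<K}" "{j. j < K \<and> d j = 1}"] by (auto simp: num_detected_eq_card)

lemma detected_index_less:
  assumes "d \<in> {..<K} \<rightarrow>\<^sub>E {0, 1}" "i < num_detected K d"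
  shows "detected_index K d i < K"
proof -
  have "detected_index K d i \<in> set (sorted_list_of_set {j. j < K \<and> d j = 1})"
    unfolding detected_index_def using assms by (intro nth_mem) (simp add: num_detected_eq_card)
  then show ?thesis by simp
qed

lemma detection_prob_eq_prod:
  assumes d: "d \<in> {..<K} \<rightarrow>\<^sub>E {0, 1}"
  shows "detection_prob K pD d = (\<Prod>i<K. if d i = 1 then pD else 1 - pD)"
proof -
  let ?D = "{j. j < K \<and> d j = 1}"
  have "(\<Prod>i<K. if d i = 1 then pD else 1 - pD) = pD ^ card ({..<K} \<inter> {i. d i = 1}) * (1 - pD) ^ card ({..<K} \<inter> - {i. d i = 1})"
    by (subst prod.If_cases) auto
  also have "{..<K} \<inter> {i. d i = 1} = ?D" by auto
  also have "{..<K} \<inter> - {i. d i = 1} = {..<K} - ?D" by auto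
  also have "card ({..<K} - ?D) = K - card ?D" by (subst card_Diff_subset) auto
  finally show ?thesis
    by (simp add: detection_prob_def num_detected_eq_card[OF d])
qed

lemma sum_detection_prob: "(\<Sum>d\<in>{..<K} \<rightarrow>\<^sub>E {0, 1}. detection_prob K pD d) = 1"
proof -
  have "(\<Sum>d\<in>{..<K} \<rightarrow>\<^sub>E {0, 1::nat}. detection_prob K pD d) = (\<Sum>d\<in>{..<K} \<rightarrow>\<^sub>E {0, 1::nat}. \<Prod>i<K. if d i = 1 then pD else 1 - pD)"
    by (intro sum.cong refl) (rule detection_prob_eq_prod)
  also have "\<dots> = (\<Prod>i<K. \<Sum>b\<in>{0, 1::nat}. if b = 1 then pD else 1 - pD)"
    \<comment> \<open>Distributivity: the sum over all patterns is a product of K factors, each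
      equal to (1 - pD) + pD = 1.\<close>
    by (rule prod_sum_PiE[symmetric]) auto
  finally show ?thesis by simp
qed

lemma detection_prob_nonneg: "0 \<le> pD \<Longrightarrow> pD \<le> 1 \<Longrightarrow> 0 \<le> detection_prob K pD d"
  by (simp add: detection_prob_def)

lemma finite_detections[simp]: "finite ({..<K::nat} \<rightarrow>\<^sub>E {0::nat, 1})"
  by (intro finite_PiE) auto

text \<open>Density of the i-th entry before the random permutation, when the detected targets come
  first and the clutter last. It merges the two products of the likelihood into one product over all
  positions.\<close>

definition entry_density :: "nat \<Rightarrow> ('y \<Rightarrow> real) \<Rightarrow> ('x \<Rightarrow> 'y \<Rightarrow> real) \<Rightarrow> (nat \<Rightarrow> 'x) \<Rightarrow> (nat \<Rightarrow> nat) \<Rightarrow> nat \<Rightarrow> 'y \<Rightarrow> real" where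
  "entry_density K p g x d i = (if i < num_detected K d then g (x (detected_index K d i)) else p)"

lemma mt_likelihood_eq:
  "mt_likelihood K pD lam p g x ys =
     (\<Sum>d \<in> {d \<in> {..<K} \<rightarrow>\<^sub>E {0, 1}. num_detected K d \<le> length ys}.
        pmf (clutter_count lam) (length ys - num_detected K d) * detection_prob K pD d * (1 / fact (length ys)) *
        (\<Sum>\<sigma> | \<sigma> permutes {..<length ys}. \<Prod>i<length ys. entry_density K p g x d i (ys ! \<sigma> i)))"
proof -
  have "(\<Prod>i\<in>{m..<M}. p (ys ! \<sigma> i)) * (\<Prod>i<m. g (x (detected_index K d i)) (ys ! \<sigma> i))
     = (\<Prod>i<M. entry_density K p g x d i (ys ! \<sigma> i))"
    if m: "m = num_detected K d" "m \<le> M" for d m M \<sigma>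
  proof -
    have M: "{..<M} = {m..<M} \<union> {..<m}" using m by auto
    have "(\<Prod>i<M. entry_density K p g x d i (ys ! \<sigma> i))
      = (\<Prod>i\<in>{m..<M}. entry_density K p g x d i (ys ! \<sigma> i)) * (\<Prod>i<m. entry_density K p g x d i (ys ! \<sigma> i))"
      unfolding M by (rule prod.union_disjoint) auto
    then show ?thesis using m by (simp add: entry_density_def)
  qed
  then show ?thesis
    unfolding mt_likelihood_def Let_def by (intro sum.cong arg_cong2[where f="(*)"] refl) auto
qed

locale mt_densities =
  fixes M :: "'x measure" and N :: "'y measure" and g :: "'x \<Rightarrow> 'y \<Rightarrow> real"
    and K :: nat and pD lam :: real and p :: "'y \<Rightarrow> real"
  assumes M: "sigma_finite_measure M" and N: "sigma_finite_measure N" and ne: "space M \<noteq> {}"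
    and g: "cond_density M N g"
    and pD: "0 \<le> pD" "pD \<le> 1"
    and p: "p \<in> borel_measurable N" "\<And>y. y \<in> space N \<Longrightarrow> 0 \<le> p y"
    and clutter: "lam = 0 \<or> prob_density N p"
begin

sublocale M: sigma_finite_measure M by (rule M)
sublocale N: sigma_finite_measure N by (rule N)

lemmas [measurable] = cond_density_measurable[OF g] p(1)

abbreviation "detections n \<equiv> {d \<in> {..<K} \<rightarrow>\<^sub>E {0::nat, 1}. num_detected K d \<le> n}"

lemma space_N_nonempty: "space N \<noteq> {}"
proof -
  obtain x where "x \<in> space M" using ne by auto
  then have "prob_space (density N (g x))"
    by (intro prob_space_density_prob_density cond_density_prob_density[OF g])
  from prob_space.not_empty[OF this] show ?thesis by simp
qed

lemma entry_density_measurable: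
  assumes "x \<in> space (PiM {..<K} (\<lambda>_. M))" "d \<in> {..<K} \<rightarrow>\<^sub>E {0, 1}"
  shows "entry_density K p g x d i \<in> borel_measurable N"
  using assms detected_index_less[OF assms(2), of i]
  by (auto simp: entry_density_def space_PiM PiE_iff intro!: prob_density_measurable cond_density_prob_density[OF g])

lemma entry_density_nonneg:
  assumes "x \<in> space (PiM {..<K} (\<lambda>_. M))" "d \<in> {..<K} \<rightarrow>\<^sub>E {0, 1}" "y \<in> space N"
  shows "0 \<le> entry_density K p g x d i y"
proof (cases "i < num_detected K d")
  case True
  then have "prob_density N (g (x (detected_index K d i)))"
    using assms detected_index_less[OF assms(2) True]
    by (intro cond_density_prob_density[OF g]) (auto simp: space_PiM PiE_iff)
  then show ?thesis using True assms(3) by (simp add: entry_density_def prob_density_def)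
qed (simp add: entry_density_def p assms)

text \<open>The index sets of the sums depend on the length of the sequence. For each fixed length n
  the formula is a finite combination of measurable functions \<open>F n\<close>, with default
  values for missing entries; these are then glued along the countably many values of the
  length.\<close>

lemma mt_likelihood_measurable:
  "(\<lambda>(x, ys). mt_likelihood K pD lam p g x ys) \<in> borel_measurable (PiM {..<K} (\<lambda>_. M) \<Otimes>\<^sub>M seq_measure N)"
proof -
  obtain a where a: "a \<in> space N" using space_N_nonempty by auto
  let ?nth = "\<lambda>i ys. if i < length ys then ys ! i else a"
  note measurable_nth_seq[OF a, measurable]
  define F where "F n z = (\<Sum>d \<in> detections n.
        pmf (clutter_count lam) (n - num_detected K d) * detection_prob K pD d * (1 / fact n) *
        (\<Sum>\<sigma> | \<sigma> permutes {..<n}. \<Prod>i<n. entry_density K p g (fst z) d i (?nth (\<sigma> i) (snd z))))"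
    for n :: nat and z
  have "(\<lambda>z. entry_density K p g (fst z) d i (?nth j (snd z))) \<in> borel_measurable (PiM {..<K} (\<lambda>_. M) \<Otimes>\<^sub>M seq_measure N)"
    if d: "d \<in> {..<K} \<rightarrow>\<^sub>E {0, 1}" for d i j
  proof (cases "i < num_detected K d")
    case True
    then have [measurable]: "(\<lambda>x. x (detected_index K d i)) \<in> PiM {..<K} (\<lambda>_. M) \<rightarrow>\<^sub>M M"
      using detected_index_less[OF d] by (intro measurable_component_singleton) auto
    have "(\<lambda>z. (\<lambda>(x, y). g x y) (fst z (detected_index K d i), ?nth j (snd z))) \<in> borel_measurable (PiM {..<K} (\<lambda>_. M) \<Otimes>\<^sub>M seq_measure N)"
      by measurable
    then show ?thesis using True by (simp add: entry_density_def)
  next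
    case False
    have "(\<lambda>z. p (?nth j (snd z))) \<in> borel_measurable (PiM {..<K} (\<lambda>_. M) \<Otimes>\<^sub>M seq_measure N)"
      by measurable
    then show ?thesis using False by (simp add: entry_density_def)
  qed
  then have F: "F n \<in> borel_measurable (PiM {..<K} (\<lambda>_. M) \<Otimes>\<^sub>M seq_measure N)" for n
    unfolding F_def by (intro borel_measurable_sum borel_measurable_times borel_measurable_prod borel_measurable_const) auto
  have "(\<lambda>z. F (length (snd z)) z) \<in> borel_measurable (PiM {..<K} (\<lambda>_. M) \<Otimes>\<^sub>M seq_measure N)"
    by (rule measurable_compose_countable[OF F]) measurable
  moreover have "F (length ys) (x, ys) = mt_likelihood K pD lam p g x ys" for x ys
  proof -
    have "?nth (\<sigma> i) ys = ys ! \<sigma> i" if "\<sigma> permutes {..<length ys}" "i < length ys" for \<sigma> i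
      using that permutes_in_image[of \<sigma> "{..<length ys}" i] by simp
    then show ?thesis
      unfolding F_def mt_likelihood_eq fst_conv snd_conv
      by (intro sum.cong prod.cong arg_cong2[where f="(*)"] refl) simp
  qed
  then have "(\<lambda>(x, ys). mt_likelihood K pD lam p g x ys) = (\<lambda>z. F (length (snd z)) z)"
    by (simp add: fun_eq_iff)
  ultimately show ?thesis by simp
qed

lemma mt_likelihood_nonneg:
  assumes "x \<in> space (PiM {..<K} (\<lambda>_. M))" "ys \<in> lists (space N)"
  shows "0 \<le> mt_likelihood K pD lam p g x ys"
  unfolding mt_likelihood_eq
proof (intro sum_nonneg mult_nonneg_nonneg prod_nonneg)
  fix d \<sigma> i assume "d \<in> detections (length ys)" "\<sigma> \<in> {\<sigma>. \<sigma> permutes {..<length ys}}" "i \<in> {..<length ys}"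
  then have "ys ! \<sigma> i \<in> set ys"
    using permutes_in_image[of \<sigma> "{..<length ys}" i] by (intro nth_mem) auto
  then show "0 \<le> entry_density K p g x d i (ys ! \<sigma> i)"
    using assms \<open>d \<in> _\<close> by (intro entry_density_nonneg) auto
qed (auto simp: pD detection_prob_nonneg)

text \<open>Reindexing by the inverse permutation only reorders the factors, so the integral is the
  same for every \<open>\<sigma>\<close>.\<close>

lemma nn_integral_permuted:
  assumes h: "\<And>i. i < n \<Longrightarrow> h i \<in> borel_measurable N" and \<sigma>: "\<sigma> permutes {..<n::nat}"
  shows "(\<integral>\<^sup>+v. (\<Prod>i<n. h i (v (\<sigma> i))) \<partial>PiM {..<n} (\<lambda>_. N)) = (\<Prod>i<n. \<integral>\<^sup>+y. h i y \<partial>N)"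
proof -
  interpret product_sigma_finite "\<lambda>_::nat. N" by unfold_locales
  have inv: "inv \<sigma> i < n \<longleftrightarrow> i < n" for i
    using permutes_in_image[OF permutes_inv[OF \<sigma>], of i] by auto
  have "(\<Prod>i<n. h i (v (\<sigma> i))) = (\<Prod>i<n. h (inv \<sigma> i) (v i))" for v
    using prod.permute[OF permutes_inv[OF \<sigma>], of "\<lambda>i. h i (v (\<sigma> i))"] by (simp add: o_def permutes_inverses[OF \<sigma>])
  moreover have "(\<integral>\<^sup>+v. (\<Prod>i<n. h (inv \<sigma> i) (v i)) \<partial>PiM {..<n} (\<lambda>_. N)) = (\<Prod>i<n. \<integral>\<^sup>+y. h (inv \<sigma> i) y \<partial>N)"
    using h inv by (intro product_nn_integral_prod[where f="\<lambda>i. h (inv \<sigma> i)"]) auto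
  moreover have "\<dots> = (\<Prod>i<n. \<integral>\<^sup>+y. h i y \<partial>N)"
    using prod.permute[OF permutes_inv[OF \<sigma>], of "\<lambda>i. \<integral>\<^sup>+y. h i y \<partial>N"] by (simp add: o_def)
  ultimately show ?thesis by simp
qed

lemma mt_likelihood_section:
  "x \<in> space (PiM {..<K} (\<lambda>_. M)) \<Longrightarrow> mt_likelihood K pD lam p g x \<in> borel_measurable (seq_measure N)"
  using measurable_compose[OF measurable_Pair1' mt_likelihood_measurable] by simp

text \<open>The box is a symmetric event, so all n! permutations contribute the same integral and
  cancel the factor 1 / n!. What remains is the mixture over detection patterns of independent
  entries in a fixed order.\<close>

lemma emeasure_mt_likelihood_box:
  assumes x: "x \<in> space (PiM {..<K} (\<lambda>_. M))" and A: "A \<in> sets N"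
  shows "emeasure (density (seq_measure N) (mt_likelihood K pD lam p g x)) (seq_box n A)
    = (\<Sum>d\<in>detections n. ennreal (pmf (clutter_count lam) (n - num_detected K d) * detection_prob K pD d)
        * (\<Prod>i<n. emeasure (density N (entry_density K p g x d i)) A))"
proof -
  note A[measurable] mt_likelihood_section[OF x, measurable]
  let ?c = "\<lambda>d. pmf (clutter_count lam) (n - num_detected K d) * detection_prob K pD d"
  let ?e = "entry_density K p g x"
  have e[measurable]: "?e d i \<in> borel_measurable N" if "d \<in> detections n" for d i
    using that by (intro entry_density_measurable x) auto
  have c: "0 \<le> ?c d" for d by (simp add: pD detection_prob_nonneg)
  \<comment> \<open>Nonnegativity of every factor lets \<open>ennreal\<close> pass inside the sums
    and products. The indicator of the box is then reindexed by \<open>\<sigma>\<close>, so that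
    each entry carries its density together with its own indicator.\<close>
  have expand: "ennreal (mt_likelihood K pD lam p g x (map v [0..<n])) * (\<Prod>i<n. indicator A (v i))
      = (\<Sum>d\<in>detections n. ennreal (?c d * (1 / fact n)) *
        (\<Sum>\<sigma> | \<sigma> permutes {..<n}. \<Prod>i<n. ennreal (?e d i (v (\<sigma> i))) * indicator A (v (\<sigma> i))))"
    if v: "v \<in> space (PiM {..<n} (\<lambda>_. N))" for v
  proof -
    have nn: "0 \<le> ?e d i (v (\<sigma> i))" if "d \<in> detections n" "\<sigma> permutes {..<n}" "i < n" for d \<sigma> i
      using that v permutes_in_image[of \<sigma> "{..<n}" i]
      by (intro entry_density_nonneg x) (auto simp: space_PiM PiE_iff)
    have c': "0 \<le> ?c d * (1 / fact n)" for d
      by (intro mult_nonneg_nonneg[OF c]) simp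
    have S: "0 \<le> (\<Sum>\<sigma> | \<sigma> permutes {..<n}. \<Prod>i<n. ?e d i (v (\<sigma> i)))" if "d \<in> detections n" for d
      by (intro sum_nonneg prod_nonneg nn that) simp_all
    have nth: "map v [0..<n] ! \<sigma> i = v (\<sigma> i)" if "\<sigma> permutes {..<n}" "i < n" for \<sigma> i
      using that permutes_in_image[of \<sigma> "{..<n}" i] by simp
    have "ennreal (mt_likelihood K pD lam p g x (map v [0..<n]))
      = ennreal (\<Sum>d\<in>detections n. ?c d * (1 / fact n) * (\<Sum>\<sigma> | \<sigma> permutes {..<n}. \<Prod>i<n. ?e d i (v (\<sigma> i))))"
      unfolding mt_likelihood_eq length_map length_upt diff_zero
      by (intro arg_cong[where f=ennreal] sum.cong prod.cong arg_cong2[where f="(*)"] refl) (simp add: nth)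
    also have "\<dots> = (\<Sum>d\<in>detections n. ennreal (?c d * (1 / fact n) * (\<Sum>\<sigma> | \<sigma> permutes {..<n}. \<Prod>i<n. ?e d i (v (\<sigma> i)))))"
    proof (rule sum_ennreal[symmetric])
      fix d assume d: "d \<in> detections n"
      show "0 \<le> ?c d * (1 / fact n) * (\<Sum>\<sigma> | \<sigma> permutes {..<n}. \<Prod>i<n. ?e d i (v (\<sigma> i)))"
        by (rule mult_nonneg_nonneg[OF c' S[OF d]])
    qed
    also have "\<dots> = (\<Sum>d\<in>detections n. ennreal (?c d * (1 / fact n)) *
        (\<Sum>\<sigma> | \<sigma> permutes {..<n}. \<Prod>i<n. ennreal (?e d i (v (\<sigma> i)))))"
    proof (intro sum.cong refl)
      fix d assume d: "d \<in> detections n"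
      have "ennreal (?c d * (1 / fact n) * (\<Sum>\<sigma> | \<sigma> permutes {..<n}. \<Prod>i<n. ?e d i (v (\<sigma> i))))
        = ennreal (?c d * (1 / fact n)) * ennreal (\<Sum>\<sigma> | \<sigma> permutes {..<n}. \<Prod>i<n. ?e d i (v (\<sigma> i)))"
        by (rule ennreal_mult[OF c' S[OF d]])
      also have "ennreal (\<Sum>\<sigma> | \<sigma> permutes {..<n}. \<Prod>i<n. ?e d i (v (\<sigma> i)))
        = (\<Sum>\<sigma> | \<sigma> permutes {..<n}. ennreal (\<Prod>i<n. ?e d i (v (\<sigma> i))))"
        using nn[OF d] by (intro sum_ennreal[symmetric] prod_nonneg) auto
      also have "\<dots> = (\<Sum>\<sigma> | \<sigma> permutes {..<n}. \<Prod>i<n. ennreal (?e d i (v (\<sigma> i))))"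
        using nn[OF d] by (intro sum.cong prod_ennreal[symmetric]) auto
      finally show "ennreal (?c d * (1 / fact n) * (\<Sum>\<sigma> | \<sigma> permutes {..<n}. \<Prod>i<n. ?e d i (v (\<sigma> i))))
        = ennreal (?c d * (1 / fact n)) * (\<Sum>\<sigma> | \<sigma> permutes {..<n}. \<Prod>i<n. ennreal (?e d i (v (\<sigma> i))))" .
    qed
    finally have "ennreal (mt_likelihood K pD lam p g x (map v [0..<n])) * (\<Prod>i<n. indicator A (v i))
      = (\<Sum>d\<in>detections n. ennreal (?c d * (1 / fact n)) *
        (\<Sum>\<sigma> | \<sigma> permutes {..<n}. (\<Prod>i<n. ennreal (?e d i (v (\<sigma> i)))) * (\<Prod>i<n. indicator A (v i))))"
      by (simp only: sum_distrib_right mult.assoc)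
    also have "\<dots> = (\<Sum>d\<in>detections n. ennreal (?c d * (1 / fact n)) *
        (\<Sum>\<sigma> | \<sigma> permutes {..<n}. \<Prod>i<n. ennreal (?e d i (v (\<sigma> i))) * indicator A (v (\<sigma> i))))"
    proof (intro sum.cong refl arg_cong2[where f="(*)"])
      fix d \<sigma> assume "\<sigma> \<in> {\<sigma>. \<sigma> permutes {..<n}}"
      then have "(\<Prod>i<n. indicator A (v i)) = (\<Prod>i<n. indicator A (v (\<sigma> i)) :: ennreal)"
        using prod.permute[of \<sigma> "{..<n}" "\<lambda>i. indicator A (v i) :: ennreal"] by (simp add: o_def)
      then show "(\<Prod>i<n. ennreal (?e d i (v (\<sigma> i)))) * (\<Prod>i<n. indicator A (v i))
        = (\<Prod>i<n. ennreal (?e d i (v (\<sigma> i))) * indicator A (v (\<sigma> i)))"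
        by (simp add: prod.distrib)
    qed
    finally show ?thesis .
  qed
  have comp: "(\<lambda>v. v (\<sigma> i)) \<in> PiM {..<n} (\<lambda>_. N) \<rightarrow>\<^sub>M N" if "\<sigma> permutes {..<n}" "i < n" for \<sigma> i
    using that permutes_in_image[of \<sigma> "{..<n}" i] by (intro measurable_component_singleton) auto
  have meas: "(\<lambda>v. \<Prod>i<n. ennreal (?e d i (v (\<sigma> i))) * indicator A (v (\<sigma> i))) \<in> borel_measurable (PiM {..<n} (\<lambda>_. N))"
    if "d \<in> detections n" "\<sigma> permutes {..<n}" for d \<sigma>
  proof (rule borel_measurable_prod_ennreal)
    fix i assume "i \<in> {..<n}"
    then show "(\<lambda>v. ennreal (?e d i (v (\<sigma> i))) * indicator A (v (\<sigma> i))) \<in> borel_measurable (PiM {..<n} (\<lambda>_. N))"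
      by (intro borel_measurable_times_ennreal measurable_compose[OF comp[OF that(2)]]
          measurable_compose[OF e[OF that(1)] measurable_ennreal] borel_measurable_indicator A) auto
  qed
  have "emeasure (density (seq_measure N) (mt_likelihood K pD lam p g x)) (seq_box n A)
    = (\<integral>\<^sup>+ys. ennreal (mt_likelihood K pD lam p g x ys) * indicator (seq_box n A) ys \<partial>seq_measure N)"
    by (rule emeasure_density) measurable
  also have "\<dots> = (\<integral>\<^sup>+v. ennreal (mt_likelihood K pD lam p g x (map v [0..<n])) * (\<Prod>i<n. indicator A (v i)) \<partial>PiM {..<n} (\<lambda>_. N))"
    by (rule nn_integral_seq_box) measurable
  also have "\<dots> = (\<integral>\<^sup>+v. (\<Sum>d\<in>detections n. ennreal (?c d * (1 / fact n)) *
        (\<Sum>\<sigma> | \<sigma> permutes {..<n}. \<Prod>i<n. ennreal (?e d i (v (\<sigma> i))) * indicator A (v (\<sigma> i)))) \<partial>PiM {..<n} (\<lambda>_. N))"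
    by (intro nn_integral_cong expand)
  also have "\<dots> = (\<Sum>d\<in>detections n. ennreal (?c d * (1 / fact n)) *
        (\<Sum>\<sigma> | \<sigma> permutes {..<n}. \<integral>\<^sup>+v. (\<Prod>i<n. ennreal (?e d i (v (\<sigma> i))) * indicator A (v (\<sigma> i))) \<partial>PiM {..<n} (\<lambda>_. N)))"
  proof -
    have "(\<integral>\<^sup>+v. ennreal (?c d * (1 / fact n)) *
        (\<Sum>\<sigma> | \<sigma> permutes {..<n}. \<Prod>i<n. ennreal (?e d i (v (\<sigma> i))) * indicator A (v (\<sigma> i))) \<partial>PiM {..<n} (\<lambda>_. N))
      = ennreal (?c d * (1 / fact n)) *
        (\<Sum>\<sigma> | \<sigma> permutes {..<n}. \<integral>\<^sup>+v. (\<Prod>i<n. ennreal (?e d i (v (\<sigma> i))) * indicator A (v (\<sigma> i))) \<partial>PiM {..<n} (\<lambda>_. N))"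
      if d: "d \<in> detections n" for d
    proof -
      have m: "(\<lambda>v. \<Prod>i<n. ennreal (?e d i (v (\<sigma> i))) * indicator A (v (\<sigma> i))) \<in> borel_measurable (PiM {..<n} (\<lambda>_. N))"
        if "\<sigma> \<in> {\<sigma>. \<sigma> permutes {..<n}}" for \<sigma>
        using that by (intro meas d) simp
      show ?thesis
        by (subst nn_integral_cmult[OF borel_measurable_sum[OF m]], assumption)
           (subst nn_integral_sum[OF m], assumption, rule refl)
    qed
    then show ?thesis
      by (intro trans[OF nn_integral_sum sum.cong[OF refl]] borel_measurable_times_ennreal
          borel_measurable_sum borel_measurable_const meas) simp_all
  qed
  also have "\<dots> = (\<Sum>d\<in>detections n. ennreal (?c d) * (\<Prod>i<n. emeasure (density N (?e d i)) A))"
  proof (intro sum.cong refl)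
    fix d assume d: "d \<in> detections n"
    have "(\<integral>\<^sup>+v. (\<Prod>i<n. ennreal (?e d i (v (\<sigma> i))) * indicator A (v (\<sigma> i))) \<partial>PiM {..<n} (\<lambda>_. N))
      = (\<Prod>i<n. emeasure (density N (?e d i)) A)" if "\<sigma> permutes {..<n}" for \<sigma>
      using nn_integral_permuted[OF _ that, of "\<lambda>i y. ennreal (?e d i y) * indicator A y"] e[OF d]
      by (simp add: emeasure_density)
    then have "(\<Sum>\<sigma> | \<sigma> permutes {..<n}. \<integral>\<^sup>+v. (\<Prod>i<n. ennreal (?e d i (v (\<sigma> i))) * indicator A (v (\<sigma> i))) \<partial>PiM {..<n} (\<lambda>_. N))
      = ennreal (fact n) * (\<Prod>i<n. emeasure (density N (?e d i)) A)"
      by (simp add: card_permutations[OF card_lessThan] ennreal_of_nat_eq_real_of_nat)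
    moreover have "ennreal (?c d * (1 / fact n)) * ennreal (fact n) = ennreal (?c d)"
      using c[of d] by (subst ennreal_mult[symmetric]) auto
    ultimately show "ennreal (?c d * (1 / fact n)) *
        (\<Sum>\<sigma> | \<sigma> permutes {..<n}. \<integral>\<^sup>+v. (\<Prod>i<n. ennreal (?e d i (v (\<sigma> i))) * indicator A (v (\<sigma> i))) \<partial>PiM {..<n} (\<lambda>_. N))
      = ennreal (?c d) * (\<Prod>i<n. emeasure (density N (?e d i)) A)"
      by (simp add: mult.assoc[symmetric])
  qed
  finally show ?thesis .
qed

lemma prod_entry_density:
  assumes d: "d \<in> detections n"
  shows "(\<Prod>i<n. emeasure (density N (entry_density K p g x d i)) A)
    = emeasure (density N p) A ^ (n - num_detected K d)
      * (\<Prod>i<num_detected K d. emeasure (density N (g (x (detected_index K d i)))) A)"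
proof -
  let ?m = "num_detected K d"
  have "?m \<le> n" using d by simp
  then have n: "{..<n} = {?m..<n} \<union> {..<?m}" by auto
  show ?thesis
    unfolding n by (subst prod.union_disjoint) (auto simp: entry_density_def)
qed

text \<open>The total mass is the sum over n of the masses of the boxes of length n over the whole
  space. For a fixed detection pattern, summing over n exhausts the clutter count distribution; the
  probabilities of the patterns then add up to 1.\<close>

lemma prob_density_mt_likelihood:
  assumes x: "x \<in> space (PiM {..<K} (\<lambda>_. M))"
  shows "prob_density (seq_measure N) (mt_likelihood K pD lam p g x)"
proof -
  let ?D = "density (seq_measure N) (mt_likelihood K pD lam p g x)"
  let ?c = "\<lambda>k d. pmf (clutter_count lam) k * detection_prob K pD d"
  \<comment> \<open>At rate 0 the dummy density has mass 0, but the only count with positive weight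
    is k = 0, where the power is 1.\<close>
  have clutter_mass: "ennreal (pmf (clutter_count lam) k) * emeasure (density N p) (space N) ^ k = ennreal (pmf (clutter_count lam) k)" for k
  proof (cases "lam = 0")
    case True
    then show ?thesis by (cases "k = 0") (auto simp: clutter_count_def)
  next
    case False
    then have "emeasure (density N p) (space N) = 1"
      using clutter prob_space_density_prob_density[of N p, THEN prob_space.emeasure_space_1] by simp
    then show ?thesis by simp
  qed
  have target_mass: "emeasure (density N (g (x (detected_index K d i)))) (space N) = 1"
    if "d \<in> {..<K} \<rightarrow>\<^sub>E {0, 1}" "i < num_detected K d" for d i
    using x detected_index_less[OF that] prob_space.emeasure_space_1[OF prob_space_density_prob_density[OF cond_density_prob_density[OF g]]]
    by (auto simp: space_PiM PiE_iff)
  have box: "emeasure ?D (seq_box n (space N)) = (\<Sum>d\<in>{..<K} \<rightarrow>\<^sub>E {0, 1}. ennreal (detection_prob K pD d) *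
      (if num_detected K d \<le> n then ennreal (pmf (clutter_count lam) (n - num_detected K d)) else 0))" for n
  proof -
    have "emeasure ?D (seq_box n (space N)) = (\<Sum>d\<in>detections n. ennreal (?c (n - num_detected K d) d)
        * emeasure (density N p) (space N) ^ (n - num_detected K d))"
      unfolding emeasure_mt_likelihood_box[OF x sets.top]
      by (intro sum.cong refl arg_cong2[where f="(*)"]) (simp add: prod_entry_density target_mass)
    also have "\<dots> = (\<Sum>d\<in>detections n. ennreal (detection_prob K pD d) * ennreal (pmf (clutter_count lam) (n - num_detected K d)))"
    proof (intro sum.cong refl)
      fix d
      show "ennreal (?c (n - num_detected K d) d) * emeasure (density N p) (space N) ^ (n - num_detected K d)
        = ennreal (detection_prob K pD d) * ennreal (pmf (clutter_count lam) (n - num_detected K d))"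
        using clutter_mass[of "n - num_detected K d"] detection_prob_nonneg[OF pD, of K d]
        by (simp add: ennreal_mult mult_ac)
    qed
    \<comment> \<open>Patterns with more than n detections are added with weight 0, so that the
      index set no longer depends on n and the two sums can be exchanged.\<close>
    also have "\<dots> = (\<Sum>d\<in>{..<K} \<rightarrow>\<^sub>E {0, 1}. ennreal (detection_prob K pD d) *
      (if num_detected K d \<le> n then ennreal (pmf (clutter_count lam) (n - num_detected K d)) else 0))"
      by (rule sum.mono_neutral_cong_left[OF finite_detections]) auto
    finally show ?thesis .
  qed
  have pmf_sum: "(\<Sum>n. if m \<le> n then ennreal (pmf (clutter_count lam) (n - m)) else 0) = 1" for m
  proof -
    have "(\<Sum>n. if m \<le> n then ennreal (pmf (clutter_count lam) (n - m)) else 0) = (\<Sum>n. ennreal (pmf (clutter_count lam) n))"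
      by (subst suminf_offset[of _ m]) auto
    also have "\<dots> = 1"
      by (simp only: nn_integral_count_space_nat[symmetric] nn_integral_pmf_eq_1)
    finally show ?thesis .
  qed
  have "emeasure ?D (space ?D) = emeasure ?D (\<Union>n. seq_box n (space N))"
    by (rule arg_cong[where f="emeasure ?D"]) (auto simp: seq_box_def)
  also have "\<dots> = (\<Sum>n. emeasure ?D (seq_box n (space N)))"
    by (rule suminf_emeasure[symmetric]) (auto simp: disjoint_family_on_def seq_box_def[of _ "space N"] intro: sets_seq_box[unfolded seq_box_def])
  also have "\<dots> = (\<Sum>d\<in>{..<K} \<rightarrow>\<^sub>E {0, 1}. \<Sum>n. ennreal (detection_prob K pD d) *
      (if num_detected K d \<le> n then ennreal (pmf (clutter_count lam) (n - num_detected K d)) else 0))"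
    unfolding box by (rule suminf_sum) simp
  also have "\<dots> = (\<Sum>d\<in>{..<K} \<rightarrow>\<^sub>E {0, 1}. ennreal (detection_prob K pD d))"
    by (simp add: pmf_sum)
  also have "\<dots> = ennreal (\<Sum>d\<in>{..<K} \<rightarrow>\<^sub>E {0, 1}. detection_prob K pD d)"
    by (intro sum_ennreal detection_prob_nonneg pD)
  also have "\<dots> = 1" by (simp only: sum_detection_prob ennreal_1)
  finally have "emeasure ?D (space (seq_measure N)) = 1" by simp
  moreover have "emeasure ?D (space (seq_measure N)) = (\<integral>\<^sup>+ys. ennreal (mt_likelihood K pD lam p g x ys) \<partial>seq_measure N)"
    using mt_likelihood_section[OF x]
    by (subst emeasure_density[OF _ sets.top]) (auto intro!: nn_integral_cong simp del: space_seq_measure)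
  ultimately have "(\<integral>\<^sup>+ys. ennreal (mt_likelihood K pD lam p g x ys) \<partial>seq_measure N) = 1"
    by simp
  then show ?thesis
    using mt_likelihood_section[OF x] mt_likelihood_nonneg[OF x] by (simp add: prob_density_def)
qed

lemma cond_density_mt_likelihood:
  "cond_density (PiM {..<K} (\<lambda>_. M)) (seq_measure N) (mt_likelihood K pD lam p g)"
  using mt_likelihood_measurable prob_density_mt_likelihood by (simp add: cond_density_def)

end

section \<open>Observation laws of the multi-target model\<close>

lemma (in prob_space) nn_integral_eq_integral_bounded:
  assumes "h \<in> borel_measurable M" "\<And>x. x \<in> space M \<Longrightarrow> 0 \<le> h x" "\<And>x. x \<in> space M \<Longrightarrow> h x \<le> (C::real)"
  shows "integrable M h" "(\<integral>\<^sup>+x. ennreal (h x) \<partial>M) = ennreal (\<integral>x. h x \<partial>M)"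
proof -
  show "integrable M h"
    using assms by (intro integrable_const_bound[of _ C]) (auto intro!: AE_I2)
  then show "(\<integral>\<^sup>+x. ennreal (h x) \<partial>M) = ennreal (\<integral>x. h x \<partial>M)"
    using assms by (intro nn_integral_eq_integral) (auto intro!: AE_I2)
qed

locale mt_hmm = density_hmm M \<pi> f N g + mt_densities M N g K pD lam p
  for M :: "'x measure" and \<pi> f and N :: "'y measure" and g K pD lam p
begin

lemma mt_density_hmm:
  "density_hmm (PiM {..<K} (\<lambda>_. M)) (\<lambda>x. \<Prod>i<K. \<pi> (x i)) (\<lambda>x' x. \<Prod>i<K. f (x' i) (x i))
    (seq_measure N) (mt_likelihood K pD lam p g)"
  by (intro density_hmm.intro density_hmm_axioms.intro density_chain_PiM cond_density_mt_likelihood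
      sigma_finite_seq_measure N)

text \<open>Once the conditional box probability splits into a constant and one common function of
  each target, independence of the targets gives a K-th power. This applies to full detection
  without clutter and, as a trivial splitting, to a single target.\<close>

lemma emeasure_mt_obs_law:
  assumes J: "finite J" "J \<subseteq> {1..}" and A: "\<And>t. t \<in> J \<Longrightarrow> A t \<in> sets N"
    and box: "\<And>t x. t \<in> J \<Longrightarrow> x \<in> space (PiM {..<K} (\<lambda>_. M)) \<Longrightarrow>
      emeasure (density (seq_measure N) (mt_likelihood K pD lam p g x)) (seq_box (n t) (A t))
        = c t * (\<Prod>i<K. \<phi> t (x i))"
    and \<phi>: "\<And>t. t \<in> J \<Longrightarrow> \<phi> t \<in> borel_measurable M"
  shows "emeasure (mt_obs_law M N \<pi> f g K pD lam p)
      (prod_emb {1..} (\<lambda>_. seq_measure N) J (\<Pi>\<^sub>E t\<in>J. seq_box (n t) (A t)))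
    = (\<Prod>t\<in>J. c t) * (\<integral>\<^sup>+x. (\<Prod>t\<in>J. \<phi> t (x t)) \<partial>chain_law M \<pi> f) ^ K"
proof -
  interpret H: density_hmm "PiM {..<K} (\<lambda>_. M)" "\<lambda>x. \<Prod>i<K. \<pi> (x i)" "\<lambda>x' x. \<Prod>i<K. f (x' i) (x i)"
    "seq_measure N" "mt_likelihood K pD lam p g"
    by (rule mt_density_hmm)
  let ?C = "chain_law (PiM {..<K} (\<lambda>_. M)) (\<lambda>x. \<Prod>i<K. \<pi> (x i)) (\<lambda>x' x. \<Prod>i<K. f (x' i) (x i))"
  have "emeasure (mt_obs_law M N \<pi> f g K pD lam p)
      (prod_emb {1..} (\<lambda>_. seq_measure N) J (\<Pi>\<^sub>E t\<in>J. seq_box (n t) (A t)))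
    = (\<integral>\<^sup>+x. (\<Prod>t\<in>J. emeasure (density (seq_measure N) (mt_likelihood K pD lam p g (x t))) (seq_box (n t) (A t))) \<partial>?C)"
    unfolding mt_obs_law_def by (rule H.emeasure_hmm_obs_law[OF J]) (intro sets_seq_box A)
  also have "\<dots> = (\<integral>\<^sup>+x. (\<Prod>t\<in>J. c t) * (\<Prod>t\<in>J. \<Prod>i<K. \<phi> t (x t i)) \<partial>?C)"
    by (intro nn_integral_cong) (simp only: box H.space_chain_lawD prod.distrib[symmetric] cong: prod.cong)
  also have "\<dots> = (\<Prod>t\<in>J. c t) * (\<integral>\<^sup>+x. (\<Prod>t\<in>J. \<Prod>i<K. \<phi> t (x t i)) \<partial>?C)"
  proof (rule nn_integral_cmult)
    have "(\<lambda>x. \<phi> t (x t i)) \<in> borel_measurable (PiM UNIV (\<lambda>_::nat. PiM {..<K} (\<lambda>_. M)))" if "t \<in> J" "i < K" for t i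
    proof -
      note \<phi>[OF that(1), measurable]
      have [measurable]: "(\<lambda>x. x i) \<in> PiM {..<K} (\<lambda>_. M) \<rightarrow>\<^sub>M M"
        using that(2) by (intro measurable_component_singleton) simp
      show ?thesis by measurable
    qed
    then show "(\<lambda>x. \<Prod>t\<in>J. \<Prod>i<K. \<phi> t (x t i)) \<in> borel_measurable ?C"
      unfolding measurable_cong_sets[OF H.sets_chain_law refl]
      by (intro borel_measurable_prod_ennreal) simp
  qed
  also have "\<dots> = (\<Prod>t\<in>J. c t) * (\<integral>\<^sup>+x. (\<Prod>t\<in>J. \<phi> t (x t)) \<partial>chain_law M \<pi> f) ^ K"
    by (simp only: nn_integral_chain_law_PiM[OF J(1) \<phi>])
  finally show ?thesis .
qed

end

subsection \<open>No clutter\<close>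

lemma detected_index_all:
  assumes "d \<in> {..<K} \<rightarrow>\<^sub>E {1::nat}" "i < K"
  shows "detected_index K d i = i"
proof -
  have "{j. j < K \<and> d j = 1} = {0..<K}" using assms(1) by (auto simp: PiE_iff)
  then show ?thesis using assms(2) by (simp add: detected_index_def)
qed

lemma all_detected_iff:
  assumes "d \<in> {..<K} \<rightarrow>\<^sub>E {0::nat, 1}"
  shows "num_detected K d = K \<longleftrightarrow> d = (\<lambda>i\<in>{..<K}. 1)"
proof
  assume "num_detected K d = K"
  then have "card {j. j < K \<and> d j = 1} = card {..<K}"
    by (simp add: num_detected_eq_card[OF assms])
  then have "{j. j < K \<and> d j = 1} = {..<K}"
    by (intro card_subset_eq) auto
  then have "d j = 1" if "j < K" for j
    using that by blast
  moreover have "d j = undefined" if "\<not> j < K" for j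
    using assms that by (auto simp: PiE_iff extensional_def)
  ultimately show "d = (\<lambda>i\<in>{..<K}. 1)"
    by (simp add: fun_eq_iff)
qed (simp add: num_detected_def)

lemma detection_prob_all: "detection_prob K pD (\<lambda>i\<in>{..<K}. 1) = pD ^ K"
  by (simp add: detection_prob_def num_detected_def)

locale mt_hmm_no_clutter = mt_hmm M \<pi> f N g K pD 0 "\<lambda>_. 0"
  for M :: "'x measure" and \<pi> f and N :: "'y measure" and g K pD
begin

text \<open>With the point mass at 0 as clutter count, K observations can only arise if all K
  targets are detected, so a single detection pattern survives in the sum.\<close>

lemma no_clutter_box_full:
  assumes x: "x \<in> space (PiM {..<K} (\<lambda>_. M))" and A: "A \<in> sets N"
  shows "emeasure (density (seq_measure N) (mt_likelihood K pD 0 (\<lambda>_. 0) g x)) (seq_box K A)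
    = ennreal (pD ^ K) * (\<Prod>i<K. emeasure (density N (g (x i))) A)"
proof -
  let ?d = "\<lambda>i\<in>{..<K}. 1::nat"
  have d: "?d \<in> detections K" "num_detected K ?d = K" by (auto simp: num_detected_def)
  have d1: "?d \<in> {..<K} \<rightarrow>\<^sub>E {1}" by auto
  have "pmf (clutter_count 0) (K - num_detected K e) = 0" if "e \<in> detections K - {?d}" for e
    using that all_detected_iff[of e K] by (auto simp: clutter_count_def)
  then have "emeasure (density (seq_measure N) (mt_likelihood K pD 0 (\<lambda>_. 0) g x)) (seq_box K A)
    = (\<Sum>e\<in>{?d}. ennreal (pmf (clutter_count 0) (K - num_detected K e) * detection_prob K pD e)
        * (\<Prod>i<K. emeasure (density N (entry_density K (\<lambda>_. 0) g x e i)) A))"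
    unfolding emeasure_mt_likelihood_box[OF x A]
    by (intro sum.mono_neutral_right finite_subset[OF _ finite_detections[of K]]) (use d in auto)
  also have "\<dots> = ennreal (pD ^ K) * (\<Prod>i<K. emeasure (density N (g (x i))) A)"
    using d by (simp add: clutter_count_def detection_prob_all entry_density_def detected_index_all[OF d1] del: One_nat_def)
  finally show ?thesis .
qed

lemma no_clutter_box_empty:
  assumes x: "x \<in> space (PiM {..<K} (\<lambda>_. M))" and A: "A \<in> sets N" and n: "K < n"
  shows "emeasure (density (seq_measure N) (mt_likelihood K pD 0 (\<lambda>_. 0) g x)) (seq_box n A) = 0"
  unfolding emeasure_mt_likelihood_box[OF x A]
proof (rule sum.neutral, rule ballI)
  fix d assume "d \<in> detections n"
  then have "num_detected K d < n" using num_detected_le[of d K] n by auto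
  then show "ennreal (pmf (clutter_count 0) (n - num_detected K d) * detection_prob K pD d)
      * (\<Prod>i<n. emeasure (density N (entry_density K (\<lambda>_. 0) g x d i)) A) = 0"
    by (simp add: clutter_count_def)
qed

lemma emeasure_no_clutter_full:
  assumes J: "finite J" "J \<subseteq> {1..}" and A: "\<And>t. t \<in> J \<Longrightarrow> A t \<in> sets N"
  shows "emeasure (mt_obs_law M N \<pi> f g K pD 0 (\<lambda>_. 0))
      (prod_emb {1..} (\<lambda>_. seq_measure N) J (\<Pi>\<^sub>E t\<in>J. seq_box K (A t)))
    = ennreal (pD ^ K) ^ card J
      * (\<integral>\<^sup>+x. (\<Prod>t\<in>J. emeasure (density N (g (x t))) (A t)) \<partial>chain_law M \<pi> f) ^ K"
  by (subst emeasure_mt_obs_law[OF J A, where c="\<lambda>_. ennreal (pD ^ K)"])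
     (auto simp: no_clutter_box_full A measurable_obs_prob)

lemma emeasure_no_clutter_count:
  "emeasure (mt_obs_law M N \<pi> f g K pD 0 (\<lambda>_. 0))
      (prod_emb {1..} (\<lambda>_. seq_measure N) {1} (\<Pi>\<^sub>E t\<in>{1}. seq_box K (space N))) = ennreal (pD ^ K)"
proof -
  interpret C: prob_space "chain_law M \<pi> f" by (rule prob_space_chain_law)
  have "(\<integral>\<^sup>+x. (\<Prod>t\<in>{1}. emeasure (density N (g (x t))) (space N)) \<partial>chain_law M \<pi> f)
    = (\<integral>\<^sup>+x. 1 \<partial>chain_law M \<pi> f)"
  proof (rule nn_integral_cong)
    fix x assume "x \<in> space (chain_law M \<pi> f)"
    from prob_space.emeasure_space_1[OF prob_space_obs[OF space_chain_lawD[OF this]]]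
    show "(\<Prod>t\<in>{1}. emeasure (density N (g (x t))) (space N)) = 1" by simp
  qed
  then show ?thesis
    by (subst emeasure_no_clutter_full) (auto simp: C.emeasure_space_1 simp del: space_chain_law)
qed

lemma emeasure_no_clutter_overfull:
  assumes n: "K < n"
  shows "emeasure (mt_obs_law M N \<pi> f g K pD 0 (\<lambda>_. 0))
      (prod_emb {1..} (\<lambda>_. seq_measure N) {1} (\<Pi>\<^sub>E t\<in>{1}. seq_box n (space N))) = 0"
  by (subst emeasure_mt_obs_law[where c="\<lambda>_. 0" and \<phi>="\<lambda>_ _. 0"])
     (auto simp: no_clutter_box_empty[OF _ _ n])

end

text \<open>The bounds by 1 make both numbers finite, so that uniqueness of nonnegative real roots
  applies.\<close>

lemma ennreal_power_inj:
  fixes a b :: ennreal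
  assumes "a ^ k = b ^ k" "0 < k" "a \<le> 1" "b \<le> 1"
  shows "a = b"
proof -
  obtain r where r: "0 \<le> r" "a = ennreal r"
    using assms(3) by (cases a) (auto simp: top_unique)
  obtain s where s: "0 \<le> s" "b = ennreal s"
    using assms(4) by (cases b) (auto simp: top_unique)
  have "r ^ k = s ^ k" using assms(1) r s by (simp add: ennreal_power)
  then show ?thesis
    using power_eq_imp_eq_base[of r k s] r s assms(2) by simp
qed

lemma (in density_hmm) nn_integral_obs_prob_le_1:
  "(\<integral>\<^sup>+x. (\<Prod>t\<in>J. emeasure (density N (g (x t))) (A t)) \<partial>chain_law M \<pi> f) \<le> 1"
proof -
  interpret C: prob_space "chain_law M \<pi> f" by (rule prob_space_chain_law)
  have "(\<integral>\<^sup>+x. (\<Prod>t\<in>J. emeasure (density N (g (x t))) (A t)) \<partial>chain_law M \<pi> f) \<le> (\<integral>\<^sup>+x. 1 \<partial>chain_law M \<pi> f)"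
    by (intro nn_integral_mono prod_le_1) (auto simp del: space_chain_law dest!: space_chain_lawD intro!: prob_space.emeasure_le_1 prob_space_obs)
  then show ?thesis by (simp add: C.emeasure_space_1 del: space_chain_law)
qed

lemma no_clutter_identifiable:
  assumes H: "density_hmm M \<pi> f N g" "density_hmm M \<pi>' f' N g'"
    and K: "0 < K" "0 < K'" and pD: "0 < pD" "pD < 1" "0 < pD'" "pD' < 1"
    and ne: "space M \<noteq> {}"
    and eq: "mt_obs_law M N \<pi> f g K pD 0 (\<lambda>_. 0) = mt_obs_law M N \<pi>' f' g' K' pD' 0 (\<lambda>_. 0)"
  shows "K = K'" "pD = pD'" "hmm_obs_law M N \<pi> f g = hmm_obs_law M N \<pi>' f' g'"
proof -
  interpret H: density_hmm M \<pi> f N g by fact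
  interpret H': density_hmm M \<pi>' f' N g' by fact
  interpret T: mt_hmm_no_clutter M \<pi> f N g K pD
    by unfold_locales (use ne pD H.obs in auto)
  interpret T': mt_hmm_no_clutter M \<pi>' f' N g' K' pD'
    by unfold_locales (use ne pD H'.obs in auto)
  \<comment> \<open>Otherwise the event of K' observations at time 1 would have probability 0 under
    the first law and pD' ^ K' > 0 under the second.\<close>
  have "\<not> K < K'"
    using T.emeasure_no_clutter_overfull[of K'] T'.emeasure_no_clutter_count pD K by (auto simp: eq)
  moreover have "\<not> K' < K"
    using T'.emeasure_no_clutter_overfull[of K] T.emeasure_no_clutter_count pD K by (auto simp: eq)
  ultimately show KK: "K = K'" by simp
  have "pD ^ K = pD' ^ K"
    using T.emeasure_no_clutter_count T'.emeasure_no_clutter_count pD by (simp add: eq[unfolded KK] KK)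
  then show pp: "pD = pD'"
    using power_eq_imp_eq_base[of pD K pD'] K pD by simp
  show "hmm_obs_law M N \<pi> f g = hmm_obs_law M N \<pi>' f' g'"
  proof (rule hmm_obs_law_eqI[OF H])
    fix J :: "nat set" and A :: "nat \<Rightarrow> 'b set"
    assume J: "finite J" "J \<subseteq> {1..}" and A: "\<And>t. t \<in> J \<Longrightarrow> A t \<in> sets N"
    have "ennreal (pD ^ K) ^ card J * (\<integral>\<^sup>+x. (\<Prod>t\<in>J. emeasure (density N (g (x t))) (A t)) \<partial>chain_law M \<pi> f) ^ K
      = ennreal (pD ^ K) ^ card J * (\<integral>\<^sup>+x. (\<Prod>t\<in>J. emeasure (density N (g' (x t))) (A t)) \<partial>chain_law M \<pi>' f') ^ K"
      using T.emeasure_no_clutter_full[OF J A] T'.emeasure_no_clutter_full[OF J A] by (simp add: eq[unfolded KK pp] KK pp)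
    \<comment> \<open>In \<open>ennreal\<close> a factor can be cancelled only if it is neither 0
      nor infinite.\<close>
    moreover have "ennreal (pD ^ K) ^ card J \<noteq> 0" "ennreal (pD ^ K) ^ card J \<noteq> \<top>"
      using pD by (auto simp: ennreal_power)
    ultimately have "(\<integral>\<^sup>+x. (\<Prod>t\<in>J. emeasure (density N (g (x t))) (A t)) \<partial>chain_law M \<pi> f) ^ K
      = (\<integral>\<^sup>+x. (\<Prod>t\<in>J. emeasure (density N (g' (x t))) (A t)) \<partial>chain_law M \<pi>' f') ^ K"
      by (auto simp: ennreal_mult_cancel_left)
    then show "(\<integral>\<^sup>+x. (\<Prod>t\<in>J. emeasure (density N (g (x t))) (A t)) \<partial>chain_law M \<pi> f)
      = (\<integral>\<^sup>+x. (\<Prod>t\<in>J. emeasure (density N (g' (x t))) (A t)) \<partial>chain_law M \<pi>' f')"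
      by (rule ennreal_power_inj[OF _ K(1) H.nn_integral_obs_prob_le_1 H'.nn_integral_obs_prob_le_1])
  qed
qed

subsection \<open>A single target in clutter\<close>

lemma single_target_detections: "{..<1::nat} \<rightarrow>\<^sub>E {0::nat, 1} = {\<lambda>i\<in>{..<1}. 0, \<lambda>i\<in>{..<1}. 1}"
proof (intro equalityI subsetI)
  fix d assume d: "d \<in> {..<1::nat} \<rightarrow>\<^sub>E {0::nat, 1}"
  then have "d 0 = 0 \<or> d 0 = 1" by (auto simp: PiE_iff)
  moreover have "d = (\<lambda>i\<in>{..<1}. d 0)"
    using d by (auto simp: PiE_iff extensional_def fun_eq_iff)
  ultimately show "d \<in> {\<lambda>i\<in>{..<1}. 0, \<lambda>i\<in>{..<1}. 1}"
    by (metis insertI1 insertI2)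
qed (auto simp: PiE_iff extensional_def split: if_splits)

locale mt_hmm_single_target = mt_hmm M \<pi> f N g 1 pD lam p
  for M :: "'x measure" and \<pi> f and N :: "'y measure" and g pD lam p +
  assumes clutter_density: "prob_density N p" and lam_pos: "0 < lam" and pD_pos: "0 < pD" "pD < 1"
begin

sublocale C: prob_space "chain_law M \<pi> f" by (rule prob_space_chain_law)

sublocale P: prob_space "density N p" by (rule prob_space_density_prob_density[OF clutter_density])

definition obs_prob :: "'y set \<Rightarrow> 'x \<Rightarrow> real" where
  "obs_prob A x = measure (density N (g x)) A"

lemma obs_prob_nonneg: "0 \<le> obs_prob A x"
  by (simp add: obs_prob_def)

lemma obs_prob_le_1: "x \<in> space M \<Longrightarrow> obs_prob A x \<le> 1"
  unfolding obs_prob_def by (intro prob_space.prob_le_1 prob_space_obs)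

lemma emeasure_obs_eq: "x \<in> space M \<Longrightarrow> emeasure (density N (g x)) A = ennreal (obs_prob A x)"
  unfolding obs_prob_def
  using prob_space_obs[of x] by (simp add: finite_measure.emeasure_eq_measure prob_space_def)

lemma obs_prob_measurable[measurable]: "A \<in> sets N \<Longrightarrow> obs_prob A \<in> borel_measurable M"
  unfolding obs_prob_def measure_def by measurable

text \<open>Here \<open>q\<close> stands for the probability that a detected target is observed in
  \<open>A\<close>. The first summand belongs to a missed target, the second to a detected one; the
  case n = 0 is separate because n - 1 is truncated at 0.\<close>

definition box_prob :: "nat \<Rightarrow> 'y set \<Rightarrow> real \<Rightarrow> real" where
  "box_prob n A q = pmf (poisson_pmf lam) n * (1 - pD) * P.prob A ^ n
    + (if n = 0 then 0 else pmf (poisson_pmf lam) (n - 1) * pD * P.prob A ^ (n - 1) * q)"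

lemma box_prob_nonneg: "0 \<le> q \<Longrightarrow> 0 \<le> box_prob n A q"
  using pD_pos by (simp add: box_prob_def)

lemma emeasure_single_target_box:
  assumes x: "x \<in> space (PiM {..<1} (\<lambda>_. M))" and A: "A \<in> sets N"
  shows "emeasure (density (seq_measure N) (mt_likelihood 1 pD lam p g x)) (seq_box n A)
    = ennreal (box_prob n A (obs_prob A (x 0)))"
proof -
  let ?d0 = "\<lambda>i\<in>{..<1::nat}. 0::nat" and ?d1 = "\<lambda>i\<in>{..<1::nat}. 1::nat"
  have x0: "x 0 \<in> space M" using x by (auto simp: space_PiM PiE_iff)
  have cc: "clutter_count lam = poisson_pmf lam" using lam_pos by (simp add: clutter_count_def)
  have nd: "num_detected 1 ?d0 = 0" "num_detected 1 ?d1 = 1" by (simp_all add: num_detected_def)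
  have ne: "?d0 \<noteq> ?d1" by (metis nd zero_neq_one)
  have dp: "detection_prob 1 pD ?d0 = 1 - pD" "detection_prob 1 pD ?d1 = pD"
    by (simp_all only: detection_prob_def nd) simp_all
  have di: "detected_index 1 ?d1 0 = 0"
    by (rule detected_index_all) auto
  \<comment> \<open>An empty observation leaves only the pattern in which the target is
    missed.\<close>
  have det: "detections n = (if n = 0 then {?d0} else {?d0, ?d1})"
    unfolding single_target_detections using nd by auto
  let ?t = "\<lambda>d. ennreal (pmf (clutter_count lam) (n - num_detected 1 d) * detection_prob 1 pD d)
        * (\<Prod>i<n. emeasure (density N (entry_density 1 p g x d i)) A)"
  have t0: "?t ?d0 = ennreal (pmf (poisson_pmf lam) n * (1 - pD) * P.prob A ^ n)"
  proof -
    have "(\<Prod>i<n. emeasure (density N (entry_density 1 p g x ?d0 i)) A) = ennreal (P.prob A ^ n)"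
      by (subst prod_entry_density) (simp_all add: single_target_detections nd P.emeasure_eq_measure ennreal_power del: One_nat_def)
    then show ?thesis using pD_pos by (simp add: cc nd dp ennreal_mult del: One_nat_def)
  qed
  have t1: "?t ?d1 = ennreal (pmf (poisson_pmf lam) (n - 1) * pD * P.prob A ^ (n - 1) * obs_prob A (x 0))" if n: "n \<noteq> 0"
  proof -
    have "(\<Prod>i<n. emeasure (density N (entry_density 1 p g x ?d1 i)) A)
      = ennreal (P.prob A ^ (n - 1)) * (\<Prod>i<1. emeasure (density N (g (x (detected_index 1 ?d1 i)))) A)"
      using n by (subst prod_entry_density) (simp_all add: single_target_detections nd P.emeasure_eq_measure ennreal_power Suc_le_eq del: One_nat_def)
    also have "\<dots> = ennreal (P.prob A ^ (n - 1)) * ennreal (obs_prob A (x 0))"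
      using di by (simp add: emeasure_obs_eq[OF x0])
    finally show ?thesis
      using pD_pos obs_prob_nonneg[of A "x 0"] by (simp add: cc nd dp ennreal_mult mult.assoc del: One_nat_def)
  qed
  have s: "sum F {u} = F u" "u \<noteq> v \<Longrightarrow> sum F {u, v} = F u + F v" for F :: "(nat \<Rightarrow> nat) \<Rightarrow> ennreal" and u v
    by simp_all
  show ?thesis
  proof (cases "n = 0")
    case True
    then have "box_prob n A (obs_prob A (x 0)) = pmf (poisson_pmf lam) n * (1 - pD) * P.prob A ^ n"
      by (simp add: box_prob_def)
    then show ?thesis
      unfolding emeasure_mt_likelihood_box[OF x A] det if_P[OF True] s(1) t0 by simp
  next
    case False
    have "box_prob n A (obs_prob A (x 0)) = pmf (poisson_pmf lam) n * (1 - pD) * P.prob A ^ n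
      + pmf (poisson_pmf lam) (n - 1) * pD * P.prob A ^ (n - 1) * obs_prob A (x 0)"
      using False by (simp add: box_prob_def)
    then show ?thesis
      unfolding emeasure_mt_likelihood_box[OF x A] det if_not_P[OF False] s(2)[OF ne] t0 t1[OF False]
      using pD_pos obs_prob_nonneg[of A "x 0"] by (simp add: ennreal_plus)
  qed
qed

lemma emeasure_single_target:
  assumes J: "finite J" "J \<subseteq> {1..}" and A: "\<And>t. t \<in> J \<Longrightarrow> A t \<in> sets N"
  shows "emeasure (mt_obs_law M N \<pi> f g 1 pD lam p)
      (prod_emb {1..} (\<lambda>_. seq_measure N) J (\<Pi>\<^sub>E t\<in>J. seq_box (n t) (A t)))
    = (\<integral>\<^sup>+x. ennreal (\<Prod>t\<in>J. box_prob (n t) (A t) (obs_prob (A t) (x t))) \<partial>chain_law M \<pi> f)"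
proof -
  have "(\<lambda>x. ennreal (box_prob (n t) (A t) (obs_prob (A t) x))) \<in> borel_measurable M" if "t \<in> J" for t
    unfolding box_prob_def using A[OF that] by measurable
  moreover have "emeasure (density (seq_measure N) (mt_likelihood 1 pD lam p g x)) (seq_box (n t) (A t))
      = 1 * (\<Prod>i<1. ennreal (box_prob (n t) (A t) (obs_prob (A t) (x i))))"
    if "t \<in> J" "x \<in> space (PiM {..<1} (\<lambda>_. M))" for t x
    unfolding emeasure_single_target_box[OF that(2) A[OF that(1)]] by simp
  ultimately have "emeasure (mt_obs_law M N \<pi> f g 1 pD lam p)
      (prod_emb {1..} (\<lambda>_. seq_measure N) J (\<Pi>\<^sub>E t\<in>J. seq_box (n t) (A t)))
    = (\<Prod>t\<in>J. 1) * (\<integral>\<^sup>+x. (\<Prod>t\<in>J. ennreal (box_prob (n t) (A t) (obs_prob (A t) (x t)))) \<partial>chain_law M \<pi> f) ^ 1"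
    using J A by (intro emeasure_mt_obs_law)
  also have "\<dots> = (\<integral>\<^sup>+x. ennreal (\<Prod>t\<in>J. box_prob (n t) (A t) (obs_prob (A t) (x t))) \<partial>chain_law M \<pi> f)"
    by (simp add: prod_ennreal box_prob_nonneg obs_prob_nonneg)
  finally show ?thesis .
qed

lemma obs_prob_path_measurable:
  "A \<in> sets N \<Longrightarrow> (\<lambda>x. obs_prob A (x t)) \<in> borel_measurable (chain_law M \<pi> f)"
  unfolding measurable_cong_sets[OF sets_chain_law refl]
  by (rule measurable_compose[where f="\<lambda>x. x t" and N=M]) auto

lemma obs_prob_path_le_1: "x \<in> space (chain_law M \<pi> f) \<Longrightarrow> obs_prob A (x t) \<le> 1"
  by (intro obs_prob_le_1 space_chain_lawD)

definition "mean_obs_prob A = (\<integral>x. obs_prob A (x 1) \<partial>chain_law M \<pi> f)"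

lemma mean_obs_prob_nonneg: "0 \<le> mean_obs_prob A"
  unfolding mean_obs_prob_def by (intro integral_nonneg_AE AE_I2 obs_prob_nonneg)

lemma mean_obs_prob_space: "mean_obs_prob (space N) = 1"
proof -
  have "mean_obs_prob (space N) = (\<integral>x. 1 \<partial>chain_law M \<pi> f)"
    unfolding mean_obs_prob_def
  proof (intro Bochner_Integration.integral_cong refl)
    fix x assume "x \<in> space (chain_law M \<pi> f)"
    from prob_space.prob_space[OF prob_space_obs[OF space_chain_lawD[OF this, of 1]]]
    show "obs_prob (space N) (x 1) = 1" by (simp add: obs_prob_def)
  qed
  then show ?thesis by (simp add: C.prob_space del: space_chain_law)
qed

text \<open>\<open>box_prob\<close> is affine in its last argument, so its expectation is its value
  at the mean.\<close>

lemma emeasure_single_time: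
  assumes A: "A \<in> sets N"
  shows "emeasure (mt_obs_law M N \<pi> f g 1 pD lam p)
      (prod_emb {1..} (\<lambda>_. seq_measure N) {1} (\<Pi>\<^sub>E t\<in>{1}. seq_box n A)) = ennreal (box_prob n A (mean_obs_prob A))"
proof -
  have int: "integrable (chain_law M \<pi> f) (\<lambda>x. obs_prob A (x 1))"
    by (rule C.nn_integral_eq_integral_bounded(1)[OF obs_prob_path_measurable[OF A] obs_prob_nonneg obs_prob_path_le_1])
  have int': "integrable (chain_law M \<pi> f) (\<lambda>x. box_prob n A (obs_prob A (x 1)))"
    unfolding box_prob_def
    by (cases "n = 0") (simp_all only: if_True if_False refl,
      (intro Bochner_Integration.integrable_add C.integrable_const integrable_mult_right int)+)
  have "(\<integral>\<^sup>+x. ennreal (box_prob n A (obs_prob A (x 1))) \<partial>chain_law M \<pi> f)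
    = ennreal (\<integral>x. box_prob n A (obs_prob A (x 1)) \<partial>chain_law M \<pi> f)"
    by (intro nn_integral_eq_integral int' AE_I2 box_prob_nonneg obs_prob_nonneg)
  also have "(\<integral>x. box_prob n A (obs_prob A (x 1)) \<partial>chain_law M \<pi> f) = box_prob n A (mean_obs_prob A)"
    unfolding box_prob_def mean_obs_prob_def using int by (auto simp: C.prob_space simp del: space_chain_law One_nat_def)
  finally show ?thesis
    by (subst emeasure_single_target) (use A in auto)
qed

end

text \<open>The three equations compare the probabilities of 0, 1 and 2 observations. Dividing by
  the first and passing to the odds r = q / (1 - q) leaves l + r and l^2 / 2 + l r, which determine
  r^2.\<close>

lemma single_target_counts_inj:
  fixes l l' q q' :: real
  assumes l: "0 < l" "0 < l'" and q: "0 < q" "q < 1" "0 < q'" "q' < 1"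
    and m0: "exp (-l) * (1 - q) = exp (-l') * (1 - q')"
    and m1: "exp (-l) * (l * (1 - q) + q) = exp (-l') * (l' * (1 - q') + q')"
    and m2: "exp (-l) * (l\<^sup>2 / 2 * (1 - q) + l * q) = exp (-l') * (l'\<^sup>2 / 2 * (1 - q') + l' * q')"
  shows "q = q'" "l = l'"
proof -
  define r r' where "r = q / (1 - q)" and "r' = q' / (1 - q')"
  have r: "0 < r" "0 < r'" "q = r * (1 - q)" "q' = r' * (1 - q')"
    using q by (auto simp: r_def r'_def)
  define c where "c = exp (-l) * (1 - q)"
  have c: "c \<noteq> 0" using q by (simp add: c_def)
  have "c * (l + r) = c * (l' + r')"
    \<comment> \<open>By \<open>m0\<close> the constant \<open>c\<close> is also the probability of
      no observation for l' and q', so the same factor is taken out on both sides.\<close>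
    using m1 by (subst (1) c_def, subst (1) c_def[unfolded m0], subst (asm) r(3), subst (asm) r(4)) (simp add: algebra_simps)
  then have s1: "l + r = l' + r'" using c by simp
  have "c * (l\<^sup>2 / 2 + l * r) = c * (l'\<^sup>2 / 2 + l' * r')"
    using m2 by (subst (1) c_def, subst (1) c_def[unfolded m0], subst (asm) r(3), subst (asm) r(4)) (simp add: algebra_simps)
  then have s2: "l\<^sup>2 / 2 + l * r = l'\<^sup>2 / 2 + l' * r'" using c by simp
  have "r\<^sup>2 = (l + r)\<^sup>2 - 2 * (l\<^sup>2 / 2 + l * r)" by (simp add: power2_eq_square algebra_simps)
  also have "\<dots> = r'\<^sup>2" unfolding s1 s2 by (simp add: power2_eq_square algebra_simps)
  finally have rr: "r = r'" using r by (simp add: power2_eq_iff)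
  then show "l = l'" using s1 by simp
  have "q = r / (1 + r)" "q' = r' / (1 + r')"
    using q by (auto simp: r_def r'_def field_simps)
  then show "q = q'" using rr by simp
qed

text \<open>The same quadratic identity for the weights of a general set \<open>A\<close>. These may
  vanish, so only nonnegativity is available to choose the root.\<close>

lemma sum_and_square_inj:
  fixes a b a' b' :: real
  assumes "0 \<le> b" "0 \<le> b'" and s1: "a + b = a' + b'" and s2: "a\<^sup>2 / 2 + a * b = a'\<^sup>2 / 2 + a' * b'"
  shows "a = a'" "b = b'"
proof -
  have "b\<^sup>2 = (a + b)\<^sup>2 - 2 * (a\<^sup>2 / 2 + a * b)" by (simp add: power2_eq_square algebra_simps)
  also have "\<dots> = b'\<^sup>2" unfolding s1 s2 by (simp add: power2_eq_square algebra_simps)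
  finally show "b = b'" using assms by (simp add: power2_eq_iff_nonneg)
  then show "a = a'" using s1 by simp
qed

section \<open>Joint single-target probabilities from events with one observation\<close>

context mt_hmm_single_target
begin

text \<open>For n = 1 the conditional box probability is a constant plus a multiple of
  \<open>obs_prob\<close>, so \<open>obs_prob\<close> is, up to scale, a box probability minus a
  clutter term. Multiplying over \<open>J\<close> and expanding gives a sum over subsets S whose
  expectations are cylinder probabilities at the times in S. The right side therefore involves only
  the law of the observations and quantities identified beforehand.\<close>

lemma integral_prod_obs_prob:
  assumes J: "finite J" "J \<subseteq> {1..}" and A: "\<And>t. t \<in> J \<Longrightarrow> A t \<in> sets N"
  shows "(pmf (poisson_pmf lam) 0 * pD) ^ card J * (\<integral>x. (\<Prod>t\<in>J. obs_prob (A t) (x t)) \<partial>chain_law M \<pi> f)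
    = (\<Sum>S\<in>Pow J. measure (mt_obs_law M N \<pi> f g 1 pD lam p)
          (prod_emb {1..} (\<lambda>_. seq_measure N) S (\<Pi>\<^sub>E t\<in>S. seq_box 1 (A t)))
        * (\<Prod>t\<in>J - S. - (pmf (poisson_pmf lam) 1 * (1 - pD) * P.prob (A t))))"
proof -
  let ?b = "\<lambda>t x. box_prob 1 (A t) (obs_prob (A t) (x t))"
  let ?c = "\<lambda>t. pmf (poisson_pmf lam) 1 * (1 - pD) * P.prob (A t)"
  let ?C = "chain_law M \<pi> f"
  have b: "?b t x = ?c t + pmf (poisson_pmf lam) 0 * pD * obs_prob (A t) (x t)" for t x
    by (simp add: box_prob_def)
  have b0: "0 \<le> ?b t x" for t x by (intro box_prob_nonneg obs_prob_nonneg)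
  have c1: "0 \<le> ?c t \<and> ?c t \<le> 1" for t
    using pD_pos by (auto intro!: mult_le_one simp: pmf_le_1)
  have d1: "0 \<le> pmf (poisson_pmf lam) 0 * pD \<and> pmf (poisson_pmf lam) 0 * pD \<le> 1"
    using pD_pos by (auto intro!: mult_le_one simp: pmf_le_1)
  have meas: "(\<lambda>x. \<Prod>t\<in>S. ?b t x) \<in> borel_measurable ?C" if "S \<subseteq> J" for S
    unfolding b using that A by (intro borel_measurable_prod borel_measurable_add borel_measurable_times obs_prob_path_measurable borel_measurable_const) auto
  \<comment> \<open>A crude uniform bound, each of the two summands being at most 1; it gives
    integrability of all the finite products.\<close>
  have b2: "?b t x \<le> 2" if "x \<in> space ?C" for t x
  proof -
    have "pmf (poisson_pmf lam) 0 * pD * obs_prob (A t) (x t) \<le> 1"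
      using d1 obs_prob_path_le_1[OF that, of "A t" t] obs_prob_nonneg[of "A t" "x t"] by (intro mult_le_one[of "pmf (poisson_pmf lam) 0 * pD"]) auto
    then show ?thesis unfolding b using c1[of t] by linarith
  qed
  have "(\<Prod>t\<in>S. ?b t x) \<le> 2 ^ card S" if "x \<in> space ?C" for S x
    using prod_mono[of S "\<lambda>t. ?b t x" "\<lambda>_. 2"] b0 b2[OF that] by simp
  then have S: "integrable ?C (\<lambda>x. \<Prod>t\<in>S. ?b t x)"
      "(\<integral>\<^sup>+x. ennreal (\<Prod>t\<in>S. ?b t x) \<partial>?C) = ennreal (\<integral>x. (\<Prod>t\<in>S. ?b t x) \<partial>?C)" if "S \<subseteq> J" for S
    using C.nn_integral_eq_integral_bounded[OF meas[OF that], of "2 ^ card S"] b0 by (auto intro!: prod_nonneg)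
  have law: "measure (mt_obs_law M N \<pi> f g 1 pD lam p)
          (prod_emb {1..} (\<lambda>_. seq_measure N) S (\<Pi>\<^sub>E t\<in>S. seq_box 1 (A t))) = (\<integral>x. (\<Prod>t\<in>S. ?b t x) \<partial>?C)"
    if "S \<subseteq> J" for S
  proof -
    have "emeasure (mt_obs_law M N \<pi> f g 1 pD lam p)
          (prod_emb {1..} (\<lambda>_. seq_measure N) S (\<Pi>\<^sub>E t\<in>S. seq_box 1 (A t))) = ennreal (\<integral>x. (\<Prod>t\<in>S. ?b t x) \<partial>?C)"
      using that J A S(2)[OF that] by (subst emeasure_single_target) (auto intro: finite_subset)
    moreover have "0 \<le> (\<integral>x. (\<Prod>t\<in>S. ?b t x) \<partial>?C)"
      by (intro integral_nonneg_AE AE_I2 prod_nonneg b0)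
    ultimately show ?thesis
      by (simp only: measure_def enn2real_ennreal)
  qed
  have "(pmf (poisson_pmf lam) 0 * pD) ^ card J * (\<Prod>t\<in>J. obs_prob (A t) (x t))
    = (\<Sum>S\<in>Pow J. (\<Prod>t\<in>S. ?b t x) * (\<Prod>t\<in>J - S. - ?c t))" for x
  proof -
    have "(pmf (poisson_pmf lam) 0 * pD) ^ card J * (\<Prod>t\<in>J. obs_prob (A t) (x t)) = (\<Prod>t\<in>J. ?b t x + - ?c t)"
      unfolding b by (simp add: prod.distrib)
    also have "\<dots> = (\<Sum>S\<in>Pow J. (\<Prod>t\<in>S. ?b t x) * (\<Prod>t\<in>J - S. - ?c t))"
      by (rule prod_add[OF J(1)])
    finally show ?thesis .
  qed
  then have "(\<integral>x. (pmf (poisson_pmf lam) 0 * pD) ^ card J * (\<Prod>t\<in>J. obs_prob (A t) (x t)) \<partial>?C)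
    = (\<integral>x. (\<Sum>S\<in>Pow J. (\<Prod>t\<in>S. ?b t x) * (\<Prod>t\<in>J - S. - ?c t)) \<partial>?C)"
    by (simp only:)
  also have "\<dots> = (\<Sum>S\<in>Pow J. \<integral>x. (\<Prod>t\<in>S. ?b t x) * (\<Prod>t\<in>J - S. - ?c t) \<partial>?C)"
    by (intro Bochner_Integration.integral_sum integrable_mult_left S) auto
  also have "\<dots> = (\<Sum>S\<in>Pow J. measure (mt_obs_law M N \<pi> f g 1 pD lam p)
          (prod_emb {1..} (\<lambda>_. seq_measure N) S (\<Pi>\<^sub>E t\<in>S. seq_box 1 (A t))) * (\<Prod>t\<in>J - S. - ?c t))"
    by (intro sum.cong refl) (simp add: law del: One_nat_def)
  finally show ?thesis by simp
qed

lemma nn_integral_prod_obs: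
  assumes A: "\<And>t. t \<in> J \<Longrightarrow> A t \<in> sets N"
  shows "(\<integral>\<^sup>+x. (\<Prod>t\<in>J. emeasure (density N (g (x t))) (A t)) \<partial>chain_law M \<pi> f)
    = ennreal (\<integral>x. (\<Prod>t\<in>J. obs_prob (A t) (x t)) \<partial>chain_law M \<pi> f)"
proof -
  have "(\<integral>\<^sup>+x. (\<Prod>t\<in>J. emeasure (density N (g (x t))) (A t)) \<partial>chain_law M \<pi> f)
    = (\<integral>\<^sup>+x. ennreal (\<Prod>t\<in>J. obs_prob (A t) (x t)) \<partial>chain_law M \<pi> f)"
    by (intro nn_integral_cong) (simp add: emeasure_obs_eq[OF space_chain_lawD] prod_ennreal obs_prob_nonneg del: space_chain_law)
  also have "\<dots> = ennreal (\<integral>x. (\<Prod>t\<in>J. obs_prob (A t) (x t)) \<partial>chain_law M \<pi> f)"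
    using A by (intro C.nn_integral_eq_integral_bounded(2)[where C=1] borel_measurable_prod obs_prob_path_measurable
        prod_nonneg prod_le_1 conjI obs_prob_nonneg obs_prob_path_le_1) auto
  finally show ?thesis .
qed

end

lemma single_target_identifiable:
  assumes H: "density_hmm M \<pi> f N g" "density_hmm M \<pi>' f' N g'"
    and pD: "0 < pD" "pD < 1" "0 < pD'" "pD' < 1" and lam: "0 < lam" "0 < lam'"
    and p: "prob_density N p" "prob_density N p'"
    and ne: "space M \<noteq> {}"
    and eq: "mt_obs_law M N \<pi> f g 1 pD lam p = mt_obs_law M N \<pi>' f' g' 1 pD' lam' p'"
  shows "pD = pD'" "lam = lam'" "density N p = density N p'"
    "hmm_obs_law M N \<pi> f g = hmm_obs_law M N \<pi>' f' g'"
proof -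
  interpret H: density_hmm M \<pi> f N g by fact
  interpret H': density_hmm M \<pi>' f' N g' by fact
  interpret T: mt_hmm_single_target M \<pi> f N g pD lam p
    by unfold_locales (use ne pD lam p H.obs in \<open>auto simp: prob_density_def\<close>)
  interpret T': mt_hmm_single_target M \<pi>' f' N g' pD' lam' p'
    by unfold_locales (use ne pD lam p H'.obs in \<open>auto simp: prob_density_def\<close>)
  have box: "T.box_prob n A (T.mean_obs_prob A) = T'.box_prob n A (T'.mean_obs_prob A)" if "A \<in> sets N" for n A
    using T.emeasure_single_time[OF that, of n] T'.emeasure_single_time[OF that, of n]
    by (simp add: eq T.box_prob_nonneg T'.box_prob_nonneg T.mean_obs_prob_nonneg T'.mean_obs_prob_nonneg del: One_nat_def)
  have P1: "T.P.prob (space N) = 1" "T'.P.prob (space N) = 1"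
    using T.P.prob_space T'.P.prob_space by simp_all
  \<comment> \<open>For the whole space both location probabilities are 1 and only the number of
    observations matters; the counts 0, 1 and 2 then identify \<open>pD\<close> and
    \<open>lam\<close>.\<close>
  note total = box[OF sets.top, unfolded T.box_prob_def T'.box_prob_def P1 T.mean_obs_prob_space T'.mean_obs_prob_space]
  note po = pmf_poisson[OF lam(1)] pmf_poisson[OF lam(2)]
  show pp: "pD = pD'" and ll: "lam = lam'"
    using total[of 0] total[of 1] total[of 2] pD lam
    by (intro single_target_counts_inj[of lam lam' pD pD'], simp_all add: po algebra_simps power2_eq_square numeral_2_eq_2)+
  have PM: "T.P.prob A = T'.P.prob A \<and> T.mean_obs_prob A = T'.mean_obs_prob A" if A: "A \<in> sets N" for A
  proof -
    \<comment> \<open>The odds of detection \<open>r\<close> and the probability \<open>c\<close> of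
      no observation are common to both laws by now. The facts \<open>b1\<close> and
      \<open>b2\<close> below take \<open>c\<close> out of the probabilities of boxes of length 1
      and 2.\<close>
    define r where "r = pD / (1 - pD)"
    have r: "0 < r" "pD = r * (1 - pD)" using pD by (auto simp: r_def)
    define c where "c = exp (- lam) * (1 - pD)"
    have c: "c \<noteq> 0" using pD by (simp add: c_def)
    let ?a = "lam * T.P.prob A" and ?a' = "lam * T'.P.prob A"
    let ?b = "r * T.mean_obs_prob A" and ?b' = "r * T'.mean_obs_prob A"
    have "c * r = exp (- lam) * (r * (1 - pD))" by (simp add: c_def)
    then have q: "exp (- lam) * pD = c * r" by (simp only: r(2)[symmetric])
    have b1: "lam * exp (- lam) * (1 - pD) * P + exp (- lam) * pD * Q = c * (lam * P + r * Q)" for P Q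
    proof -
      have "c * (lam * P + r * Q) = c * (lam * P) + (c * r) * Q" by (simp add: algebra_simps)
      then show ?thesis unfolding q[symmetric] by (simp add: c_def)
    qed
    have b2: "lam\<^sup>2 / 2 * exp (- lam) * (1 - pD) * P\<^sup>2 + lam * exp (- lam) * pD * P * Q
        = c * ((lam * P)\<^sup>2 / 2 + (lam * P) * (r * Q))" for P Q
    proof -
      have "c * ((lam * P)\<^sup>2 / 2 + (lam * P) * (r * Q)) = c * ((lam * P)\<^sup>2 / 2) + (c * r) * (lam * P * Q)"
        by (simp add: algebra_simps)
      then show ?thesis unfolding q[symmetric] by (simp add: c_def power_mult_distrib)
    qed
    have "c * (?a + ?b) = c * (?a' + ?b')"
      using box[OF A, of 1, unfolded T.box_prob_def T'.box_prob_def]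
      by (simp add: po pp[symmetric] ll[symmetric] b1[symmetric])
    moreover have "c * (?a\<^sup>2 / 2 + ?a * ?b) = c * (?a'\<^sup>2 / 2 + ?a' * ?b')"
      using box[OF A, of 2, unfolded T.box_prob_def T'.box_prob_def]
      by (simp add: po pp[symmetric] ll[symmetric] b2[symmetric])
    ultimately have "?a = ?a'" "?b = ?b'"
      using sum_and_square_inj[of ?b ?b' ?a ?a'] c r T.mean_obs_prob_nonneg T'.mean_obs_prob_nonneg by simp_all
    then show ?thesis using lam r by simp
  qed
  show "density N p = density N p'"
    by (rule measure_eqI) (simp_all add: T.P.emeasure_eq_measure T'.P.emeasure_eq_measure PM)
  show "hmm_obs_law M N \<pi> f g = hmm_obs_law M N \<pi>' f' g'"
  proof (rule hmm_obs_law_eqI[OF H])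
    fix J :: "nat set" and A :: "nat \<Rightarrow> 'b set"
    assume J: "finite J" "J \<subseteq> {1..}" and A: "\<And>t. t \<in> J \<Longrightarrow> A t \<in> sets N"
    \<comment> \<open>The two expansions agree term by term: the laws are equal by assumption, and
      the clutter coefficients have been identified above.\<close>
    have "(\<Sum>S\<in>Pow J. measure (mt_obs_law M N \<pi> f g 1 pD lam p)
          (prod_emb {1..} (\<lambda>_. seq_measure N) S (\<Pi>\<^sub>E t\<in>S. seq_box 1 (A t)))
        * (\<Prod>t\<in>J - S. - (pmf (poisson_pmf lam) 1 * (1 - pD) * T.P.prob (A t))))
      = (\<Sum>S\<in>Pow J. measure (mt_obs_law M N \<pi>' f' g' 1 pD' lam' p')
          (prod_emb {1..} (\<lambda>_. seq_measure N) S (\<Pi>\<^sub>E t\<in>S. seq_box 1 (A t)))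
        * (\<Prod>t\<in>J - S. - (pmf (poisson_pmf lam') 1 * (1 - pD') * T'.P.prob (A t))))"
      unfolding eq unfolding pp ll using PM A by (intro sum.cong arg_cong2[where f="(*)"] prod.cong refl) auto
    from trans[OF trans[OF T.integral_prod_obs_prob[OF J A] this] T'.integral_prod_obs_prob[OF J A, symmetric]]
    have "(pmf (poisson_pmf lam) 0 * pD) ^ card J * (\<integral>x. (\<Prod>t\<in>J. T.obs_prob (A t) (x t)) \<partial>chain_law M \<pi> f)
      = (pmf (poisson_pmf lam) 0 * pD) ^ card J * (\<integral>x. (\<Prod>t\<in>J. T'.obs_prob (A t) (x t)) \<partial>chain_law M \<pi>' f')"
      by (simp only: pp[symmetric] ll[symmetric])
    \<comment> \<open>This is the probability of a detected target without clutter; being nonzero,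
      its power can be cancelled.\<close>
    moreover have "pmf (poisson_pmf lam) 0 * pD \<noteq> 0"
      using pD lam by (simp add: po)
    ultimately have "(\<integral>x. (\<Prod>t\<in>J. T.obs_prob (A t) (x t)) \<partial>chain_law M \<pi> f) = (\<integral>x. (\<Prod>t\<in>J. T'.obs_prob (A t) (x t)) \<partial>chain_law M \<pi>' f')"
      by simp
    then show "(\<integral>\<^sup>+x. (\<Prod>t\<in>J. emeasure (density N (g (x t))) (A t)) \<partial>chain_law M \<pi> f)
      = (\<integral>\<^sup>+x. (\<Prod>t\<in>J. emeasure (density N (g' (x t))) (A t)) \<partial>chain_law M \<pi>' f')"
      by (simp add: T.nn_integral_prod_obs[OF A] T'.nn_integral_prod_obs[OF A])
  qed
qed

section \<open>Application to the parametric model\<close>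

lemma (in multi_target_model) density_hmm_model:
  assumes "\<theta> \<in> \<Theta>"
  shows "density_hmm \<mu> (\<pi> \<theta>) (f \<theta>) \<nu> (g \<theta>)"
  using f[OF assms] g[OF assms] \<pi>[OF assms] sigma_finite_\<mu> sigma_finite_\<nu>
  by (intro density_hmm.intro density_chain.intro density_hmm_axioms.intro density_chain_axioms.intro)
     (simp_all add: stationary_density_def)

text \<open>The stationary density has total mass 1, which is impossible on an empty space.\<close>

lemma (in multi_target_model) space_\<mu>_nonempty:
  assumes "\<theta> \<in> \<Theta>" shows "space \<mu> \<noteq> {}"
  using \<pi>[OF assms] prob_space.not_empty[OF prob_space_density_prob_density, of \<mu> "\<pi> \<theta>"]
  by (simp add: stationary_density_def)

theorem theorem4p2:
  fixes \<mu> :: "(real ^ 'm) measure" and \<nu> :: "(real ^ 'n) measure"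
    and \<XX> :: "(real ^ 'm) set" and \<YY> :: "(real ^ 'n) set"
    and \<Theta> :: "'th :: topological_space set" and \<Psi> :: "'ps :: topological_space set"
    and ST :: "nat set" and SC :: "real set"
    and f :: "'th \<Rightarrow> real ^ 'm \<Rightarrow> real ^ 'm \<Rightarrow> real"
    and g :: "'th \<Rightarrow> real ^ 'm \<Rightarrow> real ^ 'n \<Rightarrow> real"
    and \<pi> :: "'th \<Rightarrow> real ^ 'm \<Rightarrow> real"
    and p :: "'ps \<Rightarrow> real ^ 'n \<Rightarrow> real"
    and \<theta>' :: 'th and K' :: nat and pD' lam' :: real and \<psi>' :: 'ps
  assumes model: "multi_target_model \<mu> \<nu> \<XX> \<YY> \<Theta> \<Psi> ST SC f g \<pi> p"
    and ident_\<theta>: "\<forall>\<theta>\<in>\<Theta>. obs_law \<mu> \<nu> f g \<pi> \<theta> = obs_law \<mu> \<nu> f g \<pi> \<theta>' \<longleftrightarrow> \<theta> = \<theta>'"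
    and ident_\<psi>: "\<forall>\<psi>\<in>\<Psi>. clutter_law \<nu> p \<psi> = clutter_law \<nu> p \<psi>' \<longleftrightarrow> \<psi> = \<psi>'"
  shows "((\<theta>', K', pD') \<in> params_no_clutter \<Theta> ST \<longrightarrow>
           (\<forall>\<tau> \<in> params_no_clutter \<Theta> ST.
              multi_obs_law_no_clutter \<mu> \<nu> f g \<pi> \<tau>
                = multi_obs_law_no_clutter \<mu> \<nu> f g \<pi> (\<theta>', K', pD')
              \<longleftrightarrow> \<tau> = (\<theta>', K', pD')))
       \<and> ((\<theta>', K', pD', lam', \<psi>') \<in> params_single_target \<Theta> \<Psi> ST SC \<longrightarrow>
           (\<forall>\<tau> \<in> params_single_target \<Theta> \<Psi> ST SC.
              multi_obs_law \<mu> \<nu> f g \<pi> p \<tau>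
                = multi_obs_law \<mu> \<nu> f g \<pi> p (\<theta>', K', pD', lam', \<psi>')
              \<longleftrightarrow> \<tau> = (\<theta>', K', pD', lam', \<psi>')))"
proof (intro conjI impI ballI iffI)
  interpret multi_target_model \<mu> \<nu> \<XX> \<YY> \<Theta> \<Psi> ST SC f g \<pi> p by (rule model)
  fix \<tau>
  assume true: "(\<theta>', K', pD') \<in> params_no_clutter \<Theta> ST" and "\<tau> \<in> params_no_clutter \<Theta> ST"
    and eq: "multi_obs_law_no_clutter \<mu> \<nu> f g \<pi> \<tau> = multi_obs_law_no_clutter \<mu> \<nu> f g \<pi> (\<theta>', K', pD')"
  then obtain \<theta> K pD where \<tau>: "\<tau> = (\<theta>, K, pD)" and par: "(\<theta>, K, pD) \<in> params_no_clutter \<Theta> ST"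
    by (cases \<tau>) auto
  \<comment> \<open>\<open>ST\<close> consists of positive integers, so both numbers of targets are
    positive and K-th roots can be taken.\<close>
  have \<theta>: "\<theta> \<in> \<Theta>" "\<theta>' \<in> \<Theta>" and K: "0 < K" "0 < K'" and pD: "0 < pD" "pD < 1" "0 < pD'" "pD' < 1"
    using true par ST by (auto simp: params_no_clutter_def)
  have "mt_obs_law \<mu> \<nu> (\<pi> \<theta>) (f \<theta>) (g \<theta>) K pD 0 (\<lambda>_. 0) = mt_obs_law \<mu> \<nu> (\<pi> \<theta>') (f \<theta>') (g \<theta>') K' pD' 0 (\<lambda>_. 0)"
    using eq by (simp add: \<tau> multi_obs_law_no_clutter_def)
  note ident = no_clutter_identifiable[OF density_hmm_model[OF \<theta>(1)] density_hmm_model[OF \<theta>(2)] K pD space_\<mu>_nonempty[OF \<theta>(1)] this]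
  have "\<theta> = \<theta>'"
    using ident_\<theta> \<theta> ident(3) by (simp add: obs_law_def)
  then show "\<tau> = (\<theta>', K', pD')" using ident \<tau> by simp
next
  interpret multi_target_model \<mu> \<nu> \<XX> \<YY> \<Theta> \<Psi> ST SC f g \<pi> p by (rule model)
  fix \<tau>
  assume true: "(\<theta>', K', pD', lam', \<psi>') \<in> params_single_target \<Theta> \<Psi> ST SC"
    and "\<tau> \<in> params_single_target \<Theta> \<Psi> ST SC"
    and eq: "multi_obs_law \<mu> \<nu> f g \<pi> p \<tau> = multi_obs_law \<mu> \<nu> f g \<pi> p (\<theta>', K', pD', lam', \<psi>')"
  then obtain \<theta> K pD lam \<psi> where \<tau>: "\<tau> = (\<theta>, K, pD, lam, \<psi>)"
    and par: "(\<theta>, K, pD, lam, \<psi>) \<in> params_single_target \<Theta> \<Psi> ST SC"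
    by (cases \<tau>) auto
  have \<theta>: "\<theta> \<in> \<Theta>" "\<theta>' \<in> \<Theta>" and \<psi>: "\<psi> \<in> \<Psi>" "\<psi>' \<in> \<Psi>" and K: "K = 1" "K' = 1"
    and pD: "0 < pD" "pD < 1" "0 < pD'" "pD' < 1" and lam: "0 < lam" "0 < lam'"
    using true par SC by (auto simp: params_single_target_def params_def)
  have "mt_obs_law \<mu> \<nu> (\<pi> \<theta>) (f \<theta>) (g \<theta>) 1 pD lam (p \<psi>) = mt_obs_law \<mu> \<nu> (\<pi> \<theta>') (f \<theta>') (g \<theta>') 1 pD' lam' (p \<psi>')"
    using eq by (simp add: \<tau> K multi_obs_law_def)
  note ident = single_target_identifiable[OF density_hmm_model[OF \<theta>(1)] density_hmm_model[OF \<theta>(2)] pD lam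
      p[OF \<psi>(1)] p[OF \<psi>(2)] space_\<mu>_nonempty[OF \<theta>(1)] this]
  have "\<theta> = \<theta>'"
    using ident_\<theta> \<theta> ident(4) by (simp add: obs_law_def)
  moreover have "\<psi> = \<psi>'"
    using ident_\<psi> \<psi> ident(3) by (simp add: clutter_law_def)
  ultimately show "\<tau> = (\<theta>', K', pD', lam', \<psi>')" using ident \<tau> K by simp
\<comment> \<open>The remaining goals are the converse implications, where equal parameters
  trivially give equal laws.\<close>
qed simp_all

end
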